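(* Let $W$ be the $2|1$-dimensional complex $\mathbb Z_2$-graded vector space with basis $w_1$ (odd), $w_2,w_3$ (even). For $c\in\mathbb C$ with $|c|\le1$ let $d_c=\psi^{1,1,0}_2+\psi^{1,0,1}_3c$. The cohomology of $d_c$ has the following bases (the listed elements are cocycles whose classes form a basis). (1) If $c$ is generic, i.e. $c$ is not a nonpositive rational number and neither $c$ nor $1/c$ is a positive integer: $$H^1=\langle\psi^{1,0,0}_2,\psi^{1,0,0}_3,\varphi^{0,1,0}_2,\varphi^{0,0,1}_3\rangle,\quad H^2=\langle\psi^{1,0,1}_3\rangle,\quad H^n=0\ (n>2).$$ (2) If $c=1$: $$H^1=\langle\psi^{1,0,0}_2,\psi^{1,0,0}_3,\varphi^{0,1,0}_2,\varphi^{0,0,1}_3,\varphi^{0,0,1}_2,\varphi^{0,1,0}_3\rangle,\quad H^2=\langle\psi^{1,0,1}_3,\psi^{1,0,1}_2,\psi^{1,1,0}_3\rangle,\quad H^n=0\ (n>2).$$ (3) If $m=1/c\ne1$ is a positive integer: $H^1=\langle\psi^{1,0,0}_2,\psi^{1,0,0}_3,\varphi^{0,1,0}_2,\varphi^{0,0,1}_3\rangle$; if $m>2$ then $H^2=\langle\psi^{1,0,1}_3\rangle$ and $H^m=\langle\varphi^{0,0,m}_2\rangle$, while if $m=2$ then $H^2=\langle\psi^{1,0,1}_3,\varphi^{0,0,2}_2\rangle$; $H^{m+1}=\langle\psi^{1,0,m}_2\rangle$; and $H^n=0$ for all other $n$. (4) If $c=0$: $$H^1=\langle\psi^{1,0,0}_2,\psi^{1,0,0}_3,\varphi^{0,1,0}_2,\varphi^{0,0,1}_3\rangle,\quad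 H^n=\langle\psi^{1,0,n-1}_3,\varphi^{0,0,n}_3\rangle\ (n>1).$$ (5) If $c$ is rational with $-1\le c<0$, write $\frac{c}{c-1}=\frac rs$ in lowest terms with $r,s$ positive integers. Then $$H^1=\langle\psi^{1,0,0}_2,\psi^{1,0,0}_3,\varphi^{0,1,0}_2,\varphi^{0,0,1}_3\rangle,\quad H^2=\langle\psi^{1,0,1}_3\rangle,$$ $$H^{ks+1}=\langle\varphi^{0,kr,k(s-r)+1}_3\rangle,\quad H^{ks+2}=\langle\psi^{1,kr,k(s-r)+1}_3\rangle\qquad(k\ge1),$$ and $H^n=0$ for all other $n$.
   Context: All spaces are $\mathbb Z_2$-graded over $\mathbb C$. $S(W)=\bigoplus_{n\ge1}S^n(W)$ is the symmetric coalgebra of $W$ (so $w_1^2=0$). $L_n=\mathrm{Hom}(S^n(W),W)$ for $n\ge1$, $L_0=0$, and $L=\prod_{n\ge1}L_n$ is identified with the coderivations of $S(W)$; it is a $\mathbb Z_2$-graded Lie algebra under the graded commutator $[\cdot,\cdot]$. For a multi-index $I=(i_1,i_2,i_3)$ with $i_1\in\{0,1\}$, $i_2,i_3\ge0$, put $w_I=w_1^{i_1}w_2^{i_2}w_3^{i_3}$, $I!=i_1!i_2!i_3!$, and let $\varphi^I_j\in\mathrm{Hom}(S^{|I|}(W),W)$ be given by $\varphi^I_j(w_J)=I!\,\delta^I_J\,w_j$; when this element is odd it is written $\psi^I_j$. For a codifferential $d\in L_2$ (odd, $[d,d]=0$) let $D(\varphi)=[\varphi,d]$, which maps $L_n$ to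 $L_{n+1}$ and satisfies $D^2=0$; $H^n=\ker(D:L_n\to L_{n+1})/D(L_{n-1})$ for $n\ge1$. *)

theory Defs
  imports "HOL-Analysis.Cartesian_Space" "HOL-Library.Poly_Mapping"
begin

section \<open>The graded space and its symmetric coalgebra\<close>

text \<open>
  \<open>W\<close> is \<^typ>\<open>complex ^ 3\<close> with basis \<open>w\<^sub>j = axis j 1\<close>, where \<open>w\<^sub>1\<close> is odd and \<open>w\<^sub>2\<close>, \<open>w\<^sub>3\<close> are
  even (in type \<^typ>\<open>3\<close> the numeral \<open>3\<close> is the index of the third coordinate). Truth values
  stand for elements of \<open>\<int>\<^sub>2\<close>, with \<^const>\<open>True\<close> for odd; addition in \<open>\<int>\<^sub>2\<close> is \<open>\<noteq>\<close>.

  A multi-index \<open>(i\<^sub>1, i\<^sub>2, i\<^sub>3)\<close> has \<open>i\<^sub>1 \<in> {0, 1}\<close>, so \<open>i\<^sub>1\<close> is a truth value, which is also the parity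
  of \<open>w\<^sub>I\<close>. The type \<open>sym\<close> below has the basis of all \<open>w\<^sub>I\<close>, including \<open>w\<^sub>0 = 1\<close> of degree \<open>0\<close>; the
  coalgebra \<open>S(W)\<close>, which starts in degree \<open>1\<close>, is the subspace where the coefficient of \<open>w\<^sub>0\<close>
  vanishes. Linear maps on \<open>S(W)\<close> are represented by their extensions sending \<open>w\<^sub>0\<close> to \<open>0\<close>.
\<close>

type_synonym W = "complex ^ 3"
type_synonym midx = "bool \<times> nat \<times> nat"
type_synonym sym = "midx \<Rightarrow>\<^sub>0 complex"

definition wpar :: "3 \<Rightarrow> bool" where
  "wpar j \<longleftrightarrow> j = 1"

definition i0 :: midx where
  "i0 = (False, 0, 0)"

fun mdeg :: "midx \<Rightarrow> nat" where
  "mdeg (a, b, c) = of_bool a + b + c"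

fun mfact :: "midx \<Rightarrow> nat" where
  "mfact (a, b, c) = fact (of_bool a) * fact b * fact c"

fun madd :: "midx \<Rightarrow> midx \<Rightarrow> midx" where
  "madd (a, b, c) (a', b', c') = (a \<or> a', b + b', c + c')"

text \<open>The pairs \<open>(J, K)\<close> with \<open>J + K = I\<close>, excluding \<open>j\<^sub>1 = k\<^sub>1 = 1\<close> because \<open>w\<^sub>1\<^sup>2 = 0\<close>.\<close>

definition splits :: "midx \<Rightarrow> (midx \<times> midx) set" where
  "splits I = {(J, K). madd J K = I \<and> \<not> (fst J \<and> fst K)}"

text \<open>\<open>I! / (J! K!)\<close> for \<open>I = J + K\<close>.\<close>

fun mbinom :: "midx \<Rightarrow> midx \<Rightarrow> nat" where
  "mbinom (a, b, c) (a', b', c') = ((b + b') choose b) * ((c + c') choose c)"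

definition pscale :: "complex \<Rightarrow> ('a \<Rightarrow>\<^sub>0 complex) \<Rightarrow> ('a \<Rightarrow>\<^sub>0 complex)" where
  "pscale a x = Poly_Mapping.map ((*) a) x"

definition wb :: "midx \<Rightarrow> sym" where
  "wb I = Poly_Mapping.single I 1"

definition linext :: "('a \<Rightarrow> ('b \<Rightarrow>\<^sub>0 complex)) \<Rightarrow> ('a \<Rightarrow>\<^sub>0 complex) \<Rightarrow> ('b \<Rightarrow>\<^sub>0 complex)" where
  "linext g x = (\<Sum>I\<in>Poly_Mapping.keys x. pscale (Poly_Mapping.lookup x I) (g I))"

text \<open>
  The product \<open>v w\<^sub>K\<close> in the symmetric algebra for \<open>v \<in> W\<close>. No signs occur here or below when
  factors are brought into the order \<open>w\<^sub>1, w\<^sub>2, w\<^sub>3\<close>, since at most one of them is odd.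
\<close>

definition wmul :: "W \<Rightarrow> midx \<Rightarrow> sym" where
  "wmul v K =
     (if fst K then 0 else Poly_Mapping.single (madd (True, 0, 0) K) (v $ 1))
     + Poly_Mapping.single (madd (False, 1, 0) K) (v $ 2)
     + Poly_Mapping.single (madd (False, 0, 1) K) (v $ 3)"

text \<open>The projection \<open>S(W) \<rightarrow> S\<^sup>1(W) = W\<close>.\<close>

definition pr :: "sym \<Rightarrow> W" where
  "pr x = (\<chi> j. Poly_Mapping.lookup x (j = 1, of_bool (j = 2), of_bool (j = 3)))"

section \<open>Coderivations\<close>

text \<open>
  \<open>\<Delta>(w\<^sub>I)\<close> is the sum of \<open>I! / (J! K!) w\<^sub>J \<otimes> w\<^sub>K\<close> over \<open>J + K = I\<close>, \<open>J, K \<noteq> 0\<close>, which is the usual sum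
  over shuffles with equal terms collected.
\<close>

definition coprod :: "sym \<Rightarrow> (midx \<times> midx \<Rightarrow>\<^sub>0 complex)" where
  "coprod = linext (\<lambda>I. \<Sum>(J, K) \<in> {(J, K) \<in> splits I. J \<noteq> i0 \<and> K \<noteq> i0}.
     Poly_Mapping.single (J, K) (of_nat (mbinom J K)))"

definition tens :: "sym \<Rightarrow> sym \<Rightarrow> (midx \<times> midx \<Rightarrow>\<^sub>0 complex)" where
  "tens x y = (\<Sum>A\<in>Poly_Mapping.keys x. \<Sum>B\<in>Poly_Mapping.keys y.
     Poly_Mapping.single (A, B) (Poly_Mapping.lookup x A * Poly_Mapping.lookup y B))"

text \<open>Coderivations of parity \<open>p\<close>: \<open>\<Delta> \<theta> = (\<theta> \<otimes> 1 + 1 \<otimes> \<theta>) \<Delta>\<close> with the Koszul sign in \<open>1 \<otimes> \<theta>\<close>.\<close>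

definition coderivation :: "bool \<Rightarrow> (sym \<Rightarrow> sym) \<Rightarrow> bool" where
  "coderivation p \<theta> \<longleftrightarrow>
     Vector_Spaces.linear pscale pscale \<theta> \<and>
     \<theta> (wb i0) = 0 \<and> (\<forall>x. Poly_Mapping.lookup (\<theta> x) i0 = 0) \<and>
     (\<forall>I M. Poly_Mapping.lookup (\<theta> (wb I)) M \<noteq> 0 \<longrightarrow> fst M = (p \<noteq> fst I)) \<and>
     (\<forall>x. coprod (\<theta> x) =
        linext (\<lambda>(J, K). tens (\<theta> (wb J)) (wb K)) (coprod x) +
        linext (\<lambda>(J, K). pscale (if p \<and> fst J then -1 else 1) (tens (wb J) (\<theta> (wb K)))) (coprod x))"

text \<open>
  The coderivation of \<open>S(W)\<close> with corestriction \<open>\<phi> : S(W) \<rightarrow> W\<close>; see \<open>coderivation_lift\<close>, \<open>pr_lift\<close>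
  and \<open>coderivation_unique\<close> below.
\<close>

definition lift :: "(sym \<Rightarrow> W) \<Rightarrow> sym \<Rightarrow> sym" where
  "lift \<phi> = linext (\<lambda>I. \<Sum>(J, K) \<in> splits I. pscale (of_nat (mbinom J K)) (wmul (\<phi> (wb J)) K))"

section \<open>The graded Lie algebra and cohomology\<close>

text \<open>\<open>L\<^sub>n = Hom(S\<^sup>n(W), W)\<close> for \<open>n \<ge> 1\<close>, extended by \<open>0\<close> to the other degrees, and \<open>L\<^sub>0 = 0\<close>.\<close>

definition Lsp :: "nat \<Rightarrow> (sym \<Rightarrow> W) set" where
  "Lsp n = {\<phi>. Vector_Spaces.linear pscale (*s) \<phi> \<and>
                (\<forall>I. mdeg I \<noteq> n \<or> n = 0 \<longrightarrow> \<phi> (wb I) = 0)}"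

definition wpart :: "bool \<Rightarrow> W \<Rightarrow> W" where
  "wpart p v = (\<chi> j. if wpar j = p then v $ j else 0)"

definition spart :: "bool \<Rightarrow> sym \<Rightarrow> sym" where
  "spart p = linext (\<lambda>I. if fst I = p then wb I else 0)"

text \<open>The component of parity \<open>p\<close> of \<open>\<phi>\<close>; it maps parity \<open>q\<close> to parity \<open>p + q\<close>.\<close>

definition hpart :: "bool \<Rightarrow> (sym \<Rightarrow> W) \<Rightarrow> sym \<Rightarrow> W" where
  "hpart p \<phi> x = (\<Sum>q\<in>UNIV. wpart (p \<noteq> q) (\<phi> (spart q x)))"

text \<open>
  The graded commutator \<open>\<phi> \<psi> - (-1)\<^bsup>|\<phi>||\<psi>|\<^esup> \<psi> \<phi>\<close> of coderivations, extended bilinearly to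
  inhomogeneous elements, in terms of corestrictions.
\<close>

definition bracket :: "(sym \<Rightarrow> W) \<Rightarrow> (sym \<Rightarrow> W) \<Rightarrow> sym \<Rightarrow> W" where
  "bracket \<phi> \<psi> x = (\<Sum>p\<in>UNIV. \<Sum>q\<in>UNIV.
     pr (lift (hpart p \<phi>) (lift (hpart q \<psi>) x)
         - pscale (if p \<and> q then -1 else 1) (lift (hpart q \<psi>) (lift (hpart p \<phi>) x))))"

definition coboundary :: "(sym \<Rightarrow> W) \<Rightarrow> (sym \<Rightarrow> W) \<Rightarrow> (sym \<Rightarrow> W)" where
  "coboundary d \<phi> = bracket \<phi> d"

definition cocycles :: "(sym \<Rightarrow> W) \<Rightarrow> nat \<Rightarrow> (sym \<Rightarrow> W) set" where
  "cocycles d n = {\<phi> \<in> Lsp n. coboundary d \<phi> = (\<lambda>_. 0)}"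

definition coboundaries :: "(sym \<Rightarrow> W) \<Rightarrow> nat \<Rightarrow> (sym \<Rightarrow> W) set" where
  "coboundaries d n = coboundary d ` Lsp (n - 1)"

definition cohomologous :: "(sym \<Rightarrow> W) \<Rightarrow> nat \<Rightarrow> ((sym \<Rightarrow> W) \<times> (sym \<Rightarrow> W)) set" where
  "cohomologous d n = {(\<phi>, \<psi>). \<phi> \<in> cocycles d n \<and> \<psi> \<in> cocycles d n \<and>
     (\<lambda>x. \<phi> x - \<psi> x) \<in> coboundaries d n}"

definition cohomology :: "(sym \<Rightarrow> W) \<Rightarrow> nat \<Rightarrow> (sym \<Rightarrow> W) set set" where
  "cohomology d n = cocycles d n // cohomologous d n"

text \<open>
  The entries of the list are cocycles and every class in \<open>H\<^sup>n\<close> is the class of a unique linear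
  combination of them. For the empty list this says \<open>H\<^sup>n = 0\<close>.
\<close>

definition cohomology_basis :: "(sym \<Rightarrow> W) \<Rightarrow> nat \<Rightarrow> (sym \<Rightarrow> W) list \<Rightarrow> bool" where
  "cohomology_basis d n bs \<longleftrightarrow> set bs \<subseteq> cocycles d n \<and>
     (\<forall>h \<in> cohomology d n. \<exists>!a::complex list. length a = length bs \<and>
        h = cohomologous d n `` {\<lambda>x. \<Sum>i<length bs. (a ! i) *s (bs ! i) x})"

section \<open>The elements in question\<close>

definition phi :: "midx \<Rightarrow> 3 \<Rightarrow> sym \<Rightarrow> W" where
  "phi I j x = (of_nat (mfact I) * Poly_Mapping.lookup x I) *s axis j 1"

abbreviation (input) psi :: "midx \<Rightarrow> 3 \<Rightarrow> sym \<Rightarrow> W" where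
  "psi \<equiv> phi"

definition dc :: "complex \<Rightarrow> sym \<Rightarrow> W" where
  "dc c x = psi (True, 1, 0) 2 x + c *s psi (True, 0, 1) 3 x"

section \<open>The lift is the coderivation with given corestriction\<close>

lemma lookup_pscale [simp]: "Poly_Mapping.lookup (pscale a x) k = a * Poly_Mapping.lookup x k"
  by (simp add: pscale_def Poly_Mapping.map.rep_eq when_def)

lemma lookup_wb: "Poly_Mapping.lookup (wb I) M = (if M = I then 1 else 0)"
  by (simp add: wb_def lookup_single when_def)

global_interpretation pvs: vector_space "pscale :: complex \<Rightarrow> ('a \<Rightarrow>\<^sub>0 complex) \<Rightarrow> _"
  by unfold_locales (auto intro!: poly_mapping_eqI simp: lookup_add algebra_simps)

lemma linext_superset:
  assumes "finite S" "Poly_Mapping.keys x \<subseteq> S"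
  shows "linext g x = (\<Sum>I\<in>S. pscale (Poly_Mapping.lookup x I) (g I))"
  unfolding linext_def using assms
  by (intro sum.mono_neutral_left) (auto simp: in_keys_iff)

lemma linear_linext: "Vector_Spaces.linear pscale pscale (linext g)"
proof
  fix x y :: "'a \<Rightarrow>\<^sub>0 complex" and r
  let ?S = "Poly_Mapping.keys x \<union> Poly_Mapping.keys y"
  have "Poly_Mapping.keys (x + y) \<subseteq> ?S" "Poly_Mapping.keys (pscale r x) \<subseteq> ?S"
    by (auto simp: in_keys_iff lookup_add)
  then show "linext g (x + y) = linext g x + linext g y"
      "linext g (pscale r x) = pscale r (linext g x)"
    using linext_superset[of ?S "x + y" g] linext_superset[of ?S x g] linext_superset[of ?S y g]
      linext_superset[of ?S "pscale r x" g]
    by (simp_all add: lookup_add pvs.scale_left_distrib sum.distrib pvs.scale_sum_right)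
qed

lemma linext_wb: "linext g (wb I) = g I"
  by (simp add: linext_def wb_def)

lemma lookup_linext: "Poly_Mapping.lookup (linext g x) M =
    (\<Sum>I\<in>Poly_Mapping.keys x. Poly_Mapping.lookup x I * Poly_Mapping.lookup (g I) M)"
  by (simp add: linext_def lookup_sum)

lemma sym_expand: "x = (\<Sum>I\<in>Poly_Mapping.keys x. pscale (Poly_Mapping.lookup x I) (wb I))"
  by (rule poly_mapping_eqI) (auto simp: lookup_sum lookup_wb if_distrib sum.delta in_keys_iff
      cong: if_cong)

lemma linear_eqI:
  assumes "Vector_Spaces.linear pscale s f" "Vector_Spaces.linear pscale s g" "\<And>I. f (wb I) = g (wb I)"
  shows "f x = g x"
proof -
  interpret f: Vector_Spaces.linear pscale s f by fact
  interpret g: Vector_Spaces.linear pscale s g by fact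
  show ?thesis
    by (subst (1 2) sym_expand) (simp add: f.sum f.scale g.sum g.scale assms(3))
qed


fun mle :: "midx \<Rightarrow> midx \<Rightarrow> bool" where
  "mle (a, b, c) (a', b', c') \<longleftrightarrow> (a \<longrightarrow> a') \<and> b \<le> b' \<and> c \<le> c'"

fun msub :: "midx \<Rightarrow> midx \<Rightarrow> midx" where
  "msub (a, b, c) (a', b', c') = (a \<and> \<not> a', b - b', c - c')"

lemma splits_iff: "(J, K) \<in> splits I \<longleftrightarrow> mle K I \<and> J = msub I K"
  by (cases I; cases J; cases K) (auto simp: splits_def)

lemma splits_iff': "(J, K) \<in> splits I \<longleftrightarrow> mle J I \<and> K = msub I J"
  by (cases I; cases J; cases K) (auto simp: splits_def)

lemma finite_splits [simp]: "finite (splits I)"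
proof (cases I)
  case (fields a b c)
  have "splits I \<subseteq> (UNIV \<times> {..b} \<times> {..c}) \<times> (UNIV \<times> {..b} \<times> {..c})"
    by (auto simp: splits_def fields)
  then show ?thesis by (rule finite_subset) auto
qed

lemma sum_splits_snd:
  fixes f :: "midx \<Rightarrow> complex"
  shows "(\<Sum>(J, K)\<in>splits I. if K = B then f J else 0) = (if mle B I then f (msub I B) else 0)"
proof -
  have "(\<Sum>(J, K)\<in>splits I. if K = B then f J else 0)
      = (\<Sum>p\<in>splits I. if p = (msub I B, B) then f (msub I B) else 0)"
    by (intro sum.cong) (auto simp: splits_iff split: if_splits)
  then show ?thesis by (simp add: sum.delta splits_iff)
qed

lemma sum_splits_fst:
  fixes f :: "midx \<Rightarrow> complex"
  shows "(\<Sum>(J, K)\<in>splits I. if J = A then f K else 0) = (if mle A I then f (msub I A) else 0)"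
proof -
  have "(\<Sum>(J, K)\<in>splits I. if J = A then f K else 0)
      = (\<Sum>p\<in>splits I. if p = (A, msub I A) then f (msub I A) else 0)"
    by (intro sum.cong) (auto simp: splits_iff' split: if_splits)
  then show ?thesis by (simp add: sum.delta splits_iff')
qed

lemma lookup_tens: "Poly_Mapping.lookup (tens x y) (A, B)
    = Poly_Mapping.lookup x A * Poly_Mapping.lookup y B"
proof -
  have "Poly_Mapping.lookup (tens x y) (A, B) =
      (\<Sum>A'\<in>Poly_Mapping.keys x. \<Sum>B'\<in>Poly_Mapping.keys y. if A' = A then
        (if B' = B then Poly_Mapping.lookup x A * Poly_Mapping.lookup y B else 0) else 0)"
    unfolding tens_def lookup_sum
    by (intro sum.cong) (auto simp: lookup_single when_def)
  also have "\<dots> = (\<Sum>A'\<in>Poly_Mapping.keys x. if A' = A then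
      (\<Sum>B'\<in>Poly_Mapping.keys y.
        (if B' = B then Poly_Mapping.lookup x A * Poly_Mapping.lookup y B else 0)) else 0)"
    by (intro sum.cong) auto
  also have "\<dots> = Poly_Mapping.lookup x A * Poly_Mapping.lookup y B"
    by (simp add: sum.delta in_keys_iff)
  finally show ?thesis .
qed

lemma lookup_coprod: "Poly_Mapping.lookup (coprod x) (A, B) =
    (if A \<noteq> i0 \<and> B \<noteq> i0 \<and> \<not> (fst A \<and> fst B)
     then of_nat (mbinom A B) * Poly_Mapping.lookup x (madd A B) else 0)"
proof -
  let ?S = "\<lambda>I. {(J, K) \<in> splits I. J \<noteq> i0 \<and> K \<noteq> i0}"
  have fin: "finite (?S I)" for I
    by (rule finite_subset[OF _ finite_splits[of I]]) auto
  have "(\<Sum>(J, K)\<in>?S I. Poly_Mapping.lookup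
        (Poly_Mapping.single (J, K) (of_nat (mbinom J K))) (A, B))
      = (if (A, B) \<in> ?S I then of_nat (mbinom A B) else (0::complex))" for I
  proof -
    have "(\<Sum>(J, K)\<in>?S I. Poly_Mapping.lookup
        (Poly_Mapping.single (J, K) (of_nat (mbinom J K))) (A, B))
      = (\<Sum>q\<in>?S I. if q = (A, B) then of_nat (mbinom A B) else (0::complex))"
      by (intro sum.cong) (auto simp: lookup_single when_def split: if_splits)
    then show ?thesis using fin by (simp add: sum.delta)
  qed
  then have "Poly_Mapping.lookup (coprod x) (A, B) = (\<Sum>I\<in>Poly_Mapping.keys x.
      if I = madd A B then (if A \<noteq> i0 \<and> B \<noteq> i0 \<and> \<not> (fst A \<and> fst B)
      then of_nat (mbinom A B) * Poly_Mapping.lookup x (madd A B) else 0) else 0)"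
    unfolding coprod_def lookup_linext
    by (intro sum.cong) (auto simp: lookup_sum case_prod_unfold splits_def)
  then show ?thesis by (simp add: sum.delta in_keys_iff)
qed

lemma keys_coprod_wb: "Poly_Mapping.keys (coprod (wb I)) \<subseteq> splits I"
  by (auto simp: in_keys_iff lookup_coprod lookup_wb splits_def split: if_splits)

lemma lookup_linext_coprod:
  "Poly_Mapping.lookup (linext g (coprod (wb I))) M = (\<Sum>(J, K)\<in>splits I.
     if J \<noteq> i0 \<and> K \<noteq> i0 then of_nat (mbinom J K) * Poly_Mapping.lookup (g (J, K)) M else 0)"
  unfolding linext_superset[OF finite_splits keys_coprod_wb] lookup_sum
  by (intro sum.cong refl) (auto simp: lookup_coprod lookup_wb splits_def)

lemma lookup_wmul: "Poly_Mapping.lookup (wmul v K) (m1, m2, m3) =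
   (if K = (False, m2, m3) then if m1 then v $ 1 else 0 else 0)
   + (if K = (m1, m2 - 1, m3) then if 0 < m2 then v $ 2 else 0 else 0)
   + (if K = (m1, m2, m3 - 1) then if 0 < m3 then v $ 3 else 0 else 0)"
  by (cases K) (auto simp: wmul_def lookup_add lookup_single when_def)

lemma lookup_lift: "Poly_Mapping.lookup (lift \<phi> (wb (i1, i2, i3))) (m1, m2, m3) =
   (if m1 then of_nat ((i2 choose m2) * (i3 choose m3)) * \<phi> (wb (i1, i2 - m2, i3 - m3)) $ 1 else 0)
   + (if (m1 \<longrightarrow> i1) \<and> 0 < m2 then of_nat ((i2 choose (m2 - 1)) * (i3 choose m3)) *
        \<phi> (wb (i1 \<and> \<not> m1, i2 - (m2 - 1), i3 - m3)) $ 2 else 0)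
   + (if (m1 \<longrightarrow> i1) \<and> 0 < m3 then of_nat ((i2 choose m2) * (i3 choose (m3 - 1))) *
        \<phi> (wb (i1 \<and> \<not> m1, i2 - m2, i3 - (m3 - 1))) $ 3 else 0)"
proof -
  have *: "(\<Sum>(J, K)\<in>splits (i1, i2, i3). of_nat (mbinom J K) * (if K = B then f J else 0)) =
      (if mle B (i1, i2, i3) then of_nat ((i2 choose fst (snd B)) * (i3 choose snd (snd B)))
         * f (msub (i1, i2, i3) B) else 0)" for B and f :: "midx \<Rightarrow> complex"
  proof -
    have "(\<Sum>(J, K)\<in>splits (i1, i2, i3). of_nat (mbinom J K) * (if K = B then f J else 0)) =
        (\<Sum>(J, K)\<in>splits (i1, i2, i3). if K = B then of_nat (mbinom J B) * f J else 0)"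
      by (intro sum.cong) auto
    also have "\<dots> = (if mle B (i1, i2, i3) then
        of_nat (mbinom (msub (i1, i2, i3) B) B) * f (msub (i1, i2, i3) B) else 0)"
      by (rule sum_splits_snd)
    finally show ?thesis
      by (cases B) (auto simp: binomial_symmetric[symmetric])
  qed
  have "Poly_Mapping.lookup (lift \<phi> (wb (i1, i2, i3))) (m1, m2, m3) =
    (\<Sum>(J, K)\<in>splits (i1, i2, i3). of_nat (mbinom J K) *
       (if K = (False, m2, m3) then if m1 then \<phi> (wb J) $ 1 else 0 else 0)) +
    (\<Sum>(J, K)\<in>splits (i1, i2, i3). of_nat (mbinom J K) *
       (if K = (m1, m2 - 1, m3) then if 0 < m2 then \<phi> (wb J) $ 2 else 0 else 0)) +
    (\<Sum>(J, K)\<in>splits (i1, i2, i3). of_nat (mbinom J K) *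
       (if K = (m1, m2, m3 - 1) then if 0 < m3 then \<phi> (wb J) $ 3 else 0 else 0))"
    unfolding lift_def linext_wb lookup_sum sum.distrib[symmetric]
    by (intro sum.cong refl) (auto simp: lookup_wmul distrib_left)
  then show ?thesis
    unfolding * by (auto simp: binomial_eq_0)
qed

lemma choose_triple:
  "((a + b) choose a) * (i choose (a + b)) = (i choose b) * ((i - b) choose a)"
  "((a + b) choose a) * (i choose (a + b)) = (i choose a) * ((i - a) choose b)"
proof -
  have *: "((a + b) choose b) * (i choose (a + b)) = (i choose b) * ((i - b) choose a)" for a b
  proof (cases "a + b \<le> i")
    case True
    then show ?thesis using choose_mult[of b "a + b" i] by (simp add: mult.commute)
  next
    case False
    then have "i < a + b" "i - b < a \<or> i < b" by auto
    then show ?thesis by (auto simp: binomial_eq_0)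
  qed
  have "(a + b) choose a = (a + b) choose b"
    by (metis add_diff_cancel_left' binomial_symmetric le_add1)
  then show "((a + b) choose a) * (i choose (a + b)) = (i choose b) * ((i - b) choose a)"
    using *[of a b] by simp
  show "((a + b) choose a) * (i choose (a + b)) = (i choose a) * ((i - a) choose b)"
    using *[of b a] by (simp add: add.commute)
qed

lemma choose_triple_shift:
  assumes "0 < a + b"
  shows "((a + b) choose a) * (i choose (a + b - 1)) =
    (if 0 < a then (i choose b) * ((i - b) choose (a - 1)) else 0) +
    (if 0 < b then (i choose a) * ((i - a) choose (b - 1)) else 0)"
proof (cases a; cases b)
  fix a' b' assume [simp]: "a = Suc a'" "b = Suc b'"
  show ?thesis
    using choose_triple(1)[of a' b i] choose_triple(2)[of a b' i]
    by (simp add: algebra_simps)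
qed (use assms in auto)


lemma linear_lift: "Vector_Spaces.linear pscale pscale (lift \<phi>)"
  unfolding lift_def by (rule linear_linext)

lemma lookup_lift_i0: "Poly_Mapping.lookup (lift \<phi> x) i0 = 0"
  unfolding lift_def lookup_linext lookup_sum case_prod_unfold lookup_pscale
  unfolding i0_def lookup_wmul by (simp cong: if_cong)

lemma lift_wb_i0:
  assumes "\<phi> (wb i0) = 0"
  shows "lift \<phi> (wb i0) = 0"
proof (rule poly_mapping_eqI)
  fix M show "Poly_Mapping.lookup (lift \<phi> (wb i0)) M = Poly_Mapping.lookup 0 M"
    using assms by (cases M) (simp add: i0_def lookup_lift)
qed

lemma lookup_left:
  assumes "\<theta> (wb i0) = 0"
  shows "Poly_Mapping.lookup (linext (\<lambda>(J, K). tens (\<theta> (wb J)) (wb K)) (coprod (wb I))) (A, B) =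
    (if B \<noteq> i0 \<and> mle B I then of_nat (mbinom (msub I B) B) *
       Poly_Mapping.lookup (\<theta> (wb (msub I B))) A else 0)"
proof -
  have "Poly_Mapping.lookup (linext (\<lambda>(J, K). tens (\<theta> (wb J)) (wb K)) (coprod (wb I))) (A, B) =
    (\<Sum>(J, K)\<in>splits I. if K = B then (if B \<noteq> i0 then of_nat (mbinom J B) *
       Poly_Mapping.lookup (\<theta> (wb J)) A else 0) else 0)"
    unfolding lookup_linext_coprod
    by (intro sum.cong refl) (auto simp: lookup_tens lookup_wb assms)
  also have "\<dots> = (if mle B I then (if B \<noteq> i0 then of_nat (mbinom (msub I B) B) *
       Poly_Mapping.lookup (\<theta> (wb (msub I B))) A else 0) else 0)"
    by (rule sum_splits_snd)
  finally show ?thesis by simp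
qed

lemma lookup_right:
  assumes "\<theta> (wb i0) = 0"
  shows "Poly_Mapping.lookup (linext (\<lambda>(J, K). pscale (s J) (tens (wb J) (\<theta> (wb K))))
      (coprod (wb I))) (A, B) =
    (if A \<noteq> i0 \<and> mle A I then of_nat (mbinom A (msub I A)) * (s A *
       Poly_Mapping.lookup (\<theta> (wb (msub I A))) B) else 0)"
proof -
  have "Poly_Mapping.lookup (linext (\<lambda>(J, K). pscale (s J) (tens (wb J) (\<theta> (wb K))))
      (coprod (wb I))) (A, B) =
    (\<Sum>(J, K)\<in>splits I. if J = A then (if A \<noteq> i0 then of_nat (mbinom A K) * (s A *
       Poly_Mapping.lookup (\<theta> (wb K)) B) else 0) else 0)"
    unfolding lookup_linext_coprod
    by (intro sum.cong refl) (auto simp: lookup_tens lookup_wb assms)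
  also have "\<dots> = (if mle A I then (if A \<noteq> i0 then of_nat (mbinom A (msub I A)) * (s A *
       Poly_Mapping.lookup (\<theta> (wb (msub I A))) B) else 0) else 0)"
    by (rule sum_splits_fst)
  finally show ?thesis by simp
qed

lemma mbinom_msub:
  "mle (b1, b2, b3) (i1, i2, i3) \<Longrightarrow>
     mbinom (msub (i1, i2, i3) (b1, b2, b3)) (b1, b2, b3) = (i2 choose b2) * (i3 choose b3)"
  "mle (b1, b2, b3) (i1, i2, i3) \<Longrightarrow>
     mbinom (b1, b2, b3) (msub (i1, i2, i3) (b1, b2, b3)) = (i2 choose b2) * (i3 choose b3)"
  by (auto simp: binomial_symmetric[symmetric])

lemma lookup_left':
  assumes "\<theta> (wb i0) = 0" "(b1, b2, b3) \<noteq> i0"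
  shows "Poly_Mapping.lookup (linext (\<lambda>(J, K). tens (\<theta> (wb J)) (wb K)) (coprod (wb (i1, i2, i3))))
      (A, (b1, b2, b3)) =
    (if b1 \<longrightarrow> i1 then of_nat ((i2 choose b2) * (i3 choose b3)) *
       Poly_Mapping.lookup (\<theta> (wb (i1 \<and> \<not> b1, i2 - b2, i3 - b3))) A else 0)"
proof (cases "mle (b1, b2, b3) (i1, i2, i3)")
  case True
  show ?thesis
    unfolding lookup_left[where \<theta> = \<theta>, OF assms(1)] mbinom_msub[OF True] using True assms(2) by auto
next
  case False
  then show ?thesis
    unfolding lookup_left[where \<theta> = \<theta>, OF assms(1)] using assms(2) by (auto simp: binomial_eq_0)
qed

lemma lookup_right':
  assumes "\<theta> (wb i0) = 0" "(a1, a2, a3) \<noteq> i0"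
  shows "Poly_Mapping.lookup (linext (\<lambda>(J, K). pscale (s J) (tens (wb J) (\<theta> (wb K))))
      (coprod (wb (i1, i2, i3)))) ((a1, a2, a3), B) =
    (if a1 \<longrightarrow> i1 then of_nat ((i2 choose a2) * (i3 choose a3)) * (s (a1, a2, a3) *
       Poly_Mapping.lookup (\<theta> (wb (i1 \<and> \<not> a1, i2 - a2, i3 - a3))) B) else 0)"
proof (cases "mle (a1, a2, a3) (i1, i2, i3)")
  case True
  show ?thesis
    unfolding lookup_right[where \<theta> = \<theta> and s = s, OF assms(1)] mbinom_msub[OF True]
    using True assms(2) by auto
next
  case False
  then show ?thesis
    unfolding lookup_right[where \<theta> = \<theta> and s = s, OF assms(1)]
    using assms(2) by (auto simp: binomial_eq_0)
qed

lemma term_odd: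
  fixes f :: "nat \<Rightarrow> nat \<Rightarrow> complex"
  assumes l_def: "l = of_nat (((a2 + b2) choose a2) * ((a3 + b3) choose a3)) *
      (of_nat ((i2 choose (a2 + b2)) * (i3 choose (a3 + b3))) * f (i2 - (a2 + b2)) (i3 - (a3 + b3)))"
  shows "of_nat ((i2 choose b2) * (i3 choose b3)) *
      (of_nat (((i2 - b2) choose a2) * ((i3 - b3) choose a3)) * f (i2 - b2 - a2) (i3 - b3 - a3)) = l"
    and "of_nat ((i2 choose a2) * (i3 choose a3)) *
      (of_nat (((i2 - a2) choose b2) * ((i3 - a3) choose b3)) * f (i2 - a2 - b2) (i3 - a3 - b3)) = l"
proof -
  have l: "l = of_nat ((((a2 + b2) choose a2) * (i2 choose (a2 + b2))) *
      (((a3 + b3) choose a3) * (i3 choose (a3 + b3)))) * f (i2 - (a2 + b2)) (i3 - (a3 + b3))"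
    by (simp add: l_def)
  show "of_nat ((i2 choose b2) * (i3 choose b3)) *
      (of_nat (((i2 - b2) choose a2) * ((i3 - b3) choose a3)) * f (i2 - b2 - a2) (i3 - b3 - a3)) = l"
    unfolding l choose_triple(1) by (simp add: add.commute)
  show "of_nat ((i2 choose a2) * (i3 choose a3)) *
      (of_nat (((i2 - a2) choose b2) * ((i3 - a3) choose b3)) * f (i2 - a2 - b2) (i3 - a3 - b3)) = l"
    unfolding l choose_triple(2) by simp
qed

lemma term_even:
  fixes f :: "nat \<Rightarrow> nat \<Rightarrow> complex"
  shows "of_nat (((a2 + b2) choose a2) * ((a3 + b3) choose a3)) *
      (if 0 < a2 + b2 then of_nat ((i2 choose (a2 + b2 - 1)) * (i3 choose (a3 + b3))) *
         f (i2 - (a2 + b2 - 1)) (i3 - (a3 + b3)) else 0)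
    = of_nat ((i2 choose b2) * (i3 choose b3)) * (if 0 < a2 then
        of_nat (((i2 - b2) choose (a2 - 1)) * ((i3 - b3) choose a3)) *
        f (i2 - b2 - (a2 - 1)) (i3 - b3 - a3) else 0)
    + of_nat ((i2 choose a2) * (i3 choose a3)) * (if 0 < b2 then
        of_nat (((i2 - a2) choose (b2 - 1)) * ((i3 - a3) choose b3)) *
        f (i2 - a2 - (b2 - 1)) (i3 - a3 - b3) else 0)"
proof (cases "0 < a2 + b2")
  case True
  define F where "F = f (i2 - (a2 + b2 - 1)) (i3 - (a3 + b3))"
  define P where "P = (((a3 + b3) choose a3) * (i3 choose (a3 + b3)))"
  have P: "(i3 choose b3) * ((i3 - b3) choose a3) = P" "(i3 choose a3) * ((i3 - a3) choose b3) = P"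
    unfolding P_def using choose_triple[of a3 b3 i3] by simp_all
  have F: "0 < a2 \<Longrightarrow> f (i2 - b2 - (a2 - 1)) (i3 - b3 - a3) = F"
       "0 < b2 \<Longrightarrow> f (i2 - a2 - (b2 - 1)) (i3 - a3 - b3) = F"
    by (simp_all add: F_def add.commute)
  have "of_nat (((a2 + b2) choose a2) * ((a3 + b3) choose a3)) *
      (of_nat ((i2 choose (a2 + b2 - 1)) * (i3 choose (a3 + b3))) * F)
      = of_nat ((((a2 + b2) choose a2) * (i2 choose (a2 + b2 - 1))) * P) * F"
    by (simp add: P_def)
  also have "\<dots> = (if 0 < a2 then of_nat ((i2 choose b2) * ((i2 - b2) choose (a2 - 1)) * P) * F else 0) +
    (if 0 < b2 then of_nat ((i2 choose a2) * ((i2 - a2) choose (b2 - 1)) * P) * F else 0)"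
    unfolding choose_triple_shift[OF True] by (simp add: algebra_simps)
  also have "(if 0 < a2 then of_nat ((i2 choose b2) * ((i2 - b2) choose (a2 - 1)) * P) * F else 0)
    = of_nat ((i2 choose b2) * (i3 choose b3)) * (if 0 < a2 then
        of_nat (((i2 - b2) choose (a2 - 1)) * ((i3 - b3) choose a3)) *
        f (i2 - b2 - (a2 - 1)) (i3 - b3 - a3) else 0)"
    unfolding P(1)[symmetric] using F(1) by simp
  also have "(if 0 < b2 then of_nat ((i2 choose a2) * ((i2 - a2) choose (b2 - 1)) * P) * F else 0)
    = of_nat ((i2 choose a2) * (i3 choose a3)) * (if 0 < b2 then
        of_nat (((i2 - a2) choose (b2 - 1)) * ((i3 - a3) choose b3)) *
        f (i2 - a2 - (b2 - 1)) (i3 - a3 - b3) else 0)"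
    unfolding P(2)[symmetric] using F(2) by simp
  finally show ?thesis by (simp only: F_def True if_True)
qed auto

theorem coderivation_lift:
  assumes zero: "\<phi> (wb i0) = 0"
    and hom: "\<And>I j. \<phi> (wb I) $ j \<noteq> 0 \<Longrightarrow> wpar j = (p \<noteq> fst I)"
  shows "coderivation p (lift \<phi>)"
proof -
  let ?l = "\<lambda>I. lift \<phi> (wb I)"
  let ?s = "\<lambda>J::midx. if p \<and> fst J then -1 else 1 :: complex"
  let ?R1 = "linext (\<lambda>(J, K). tens (?l J) (wb K))"
  let ?R2 = "linext (\<lambda>(J, K). pscale (?s J) (tens (wb J) (?l K)))"
  have h1: "\<phi> (wb (a, b, c)) $ 1 = 0" if "p = a" for a b c
    using hom[of "(a, b, c)" 1] that by (auto simp: wpar_def)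
  have h2: "\<phi> (wb (a, b, c)) $ 2 = 0" "\<phi> (wb (a, b, c)) $ 3 = 0" if "p \<noteq> a" for a b c
    using hom[of "(a, b, c)" 2] hom[of "(a, b, c)" 3] that by (auto simp: wpar_def)
  have par: "fst M = (p \<noteq> fst I)" if "Poly_Mapping.lookup (?l I) M \<noteq> 0" for I M
  proof -
    obtain i1 i2 i3 where I: "I = (i1, i2, i3)" by (cases I)
    obtain m1 m2 m3 where M: "M = (m1, m2, m3)" by (cases M)
    show ?thesis
      using that unfolding I M lookup_lift
      by (cases p; cases i1; cases m1) (simp_all add: h1 h2 cong: if_cong)
  qed
  have basis: "coprod (?l I) = ?R1 (coprod (wb I)) + ?R2 (coprod (wb I))" for I
  proof (rule poly_mapping_eqI)
    fix AB :: "midx \<times> midx"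
    obtain A B where AB: "AB = (A, B)" by (cases AB)
    obtain i1 i2 i3 where I: "I = (i1, i2, i3)" by (cases I)
    obtain a1 a2 a3 where A: "A = (a1, a2, a3)" by (cases A)
    obtain b1 b2 b3 where B: "B = (b1, b2, b3)" by (cases B)
    have "Poly_Mapping.lookup (coprod (?l I)) (A, B) =
        Poly_Mapping.lookup (?R1 (coprod (wb I))) (A, B)
        + Poly_Mapping.lookup (?R2 (coprod (wb I))) (A, B)"
    proof (cases "A = i0 \<or> B = i0")
      case True
      then show ?thesis
        by (auto simp: lookup_coprod lookup_left lookup_right[where s = ?s]
            lift_wb_i0[where \<phi> = \<phi>, OF zero] lookup_lift_i0)
    next
      case False
      then have nz: "A \<noteq> i0" "B \<noteq> i0" by auto
      define v where "v a j b c = \<phi> (wb (a, b, c)) $ j" for a j b c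
      have v0: "v a 1 = (\<lambda>_ _. 0)" if "p = a" for a
        using h1 that by (auto simp: v_def fun_eq_iff)
      have v1: "v a 2 = (\<lambda>_ _. 0)" "v a 3 = (\<lambda>_ _. 0)" if "p \<noteq> a" for a
        using h2 that by (auto simp: v_def fun_eq_iff)
      have t3: "of_nat (((a2 + b2) choose a2) * ((a3 + b3) choose a3)) *
          (if 0 < a3 + b3 then of_nat ((i2 choose (a2 + b2)) * (i3 choose (a3 + b3 - 1))) *
             f (i2 - (a2 + b2)) (i3 - (a3 + b3 - 1)) else 0)
        = of_nat ((i2 choose b2) * (i3 choose b3)) * (if 0 < a3 then
            of_nat (((i2 - b2) choose a2) * ((i3 - b3) choose (a3 - 1))) *
            f (i2 - b2 - a2) (i3 - b3 - (a3 - 1)) else 0)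
        + of_nat ((i2 choose a2) * (i3 choose a3)) * (if 0 < b3 then
            of_nat (((i2 - a2) choose b2) * ((i3 - a3) choose (b3 - 1))) *
            f (i2 - a2 - b2) (i3 - a3 - (b3 - 1)) else 0)" for f :: "nat \<Rightarrow> nat \<Rightarrow> complex"
        using term_even[of a3 b3 a2 b2 i3 i2 "\<lambda>x y. f y x"] by (simp only: mult.commute)
      note t2 = term_even[of a2 b2 a3 b3 i2 i3]
      note t1 = term_odd[OF refl, where ?a2.0 = a2 and ?b2.0 = b2 and ?a3.0 = a3 and ?b3.0 = b3 and ?i2.0 = i2 and ?i3.0 = i3]
      show ?thesis
        unfolding I A B lookup_coprod
          lookup_left'[where \<theta> = "lift \<phi>", OF lift_wb_i0[where \<phi> = \<phi>, OF zero] nz(2)[unfolded B]]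
          lookup_right'[where \<theta> = "lift \<phi>" and s = ?s,
            OF lift_wb_i0[where \<phi> = \<phi>, OF zero] nz(1)[unfolded A]]
          madd.simps mbinom.simps lookup_lift v_def[symmetric]
        unfolding A[symmetric] B[symmetric]
        apply (simp only: nz not_False_eq_True simp_thms)
        unfolding A B fst_conv
        apply (cases p; cases i1; cases a1; cases b1)
        apply (simp_all only: v0 v1 if_True if_False simp_thms if_cancel mult_zero_right
           add_0_left add_0_right mult_1_left mult_minus_left mult_minus_right cong: if_cong)
        apply (simp_all only: distrib_left t1[where f = "v True 1"] t1[where f = "v False 1"]
          t2[of "v True 2"] t2[of "v False 2"] t3[of "v True 3"] t3[of "v False 3"]
          mult_minus_right add.right_inverse)
        apply (simp_all only: add_ac)
        done
    qed
    then show "Poly_Mapping.lookup (coprod (?l I)) AB =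
        Poly_Mapping.lookup (?R1 (coprod (wb I)) + ?R2 (coprod (wb I))) AB"
      by (simp add: AB lookup_add)
  qed
  interpret L: Vector_Spaces.linear pscale pscale "lift \<phi>" by (rule linear_lift)
  have lin: "Vector_Spaces.linear pscale pscale coprod"
    unfolding coprod_def by (rule linear_linext)
  interpret C: Vector_Spaces.linear pscale pscale coprod by (rule lin)
  interpret R1: Vector_Spaces.linear pscale pscale ?R1 by (rule linear_linext)
  interpret R2: Vector_Spaces.linear pscale pscale ?R2 by (rule linear_linext)
  have "coprod (lift \<phi> x) = ?R1 (coprod x) + ?R2 (coprod x)" for x
    by (rule linear_eqI[where s = pscale and f = "\<lambda>x. coprod (lift \<phi> x)"
          and g = "\<lambda>x. ?R1 (coprod x) + ?R2 (coprod x)"])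
      (unfold_locales, simp_all add: basis L.add L.scale C.add C.scale R1.add R1.scale
        R2.add R2.scale pvs.scale_right_distrib)
  then show ?thesis
    unfolding coderivation_def
    using linear_lift lift_wb_i0[where \<phi> = \<phi>, OF zero] lookup_lift_i0 par by blast
qed

lemma pr_lift:
  assumes "Vector_Spaces.linear pscale (*s) \<phi>" "\<phi> (wb i0) = 0"
  shows "pr (lift \<phi> x) = \<phi> x"
proof -
  interpret L: Vector_Spaces.linear pscale pscale "lift \<phi>" by (rule linear_lift)
  have "pr (lift \<phi> (wb I)) = \<phi> (wb I)" for I
    using assms(2) by (cases I) (auto simp: pr_def vec_eq_iff forall_3 lookup_lift i0_def)
  moreover have "Vector_Spaces.linear pscale (*s) (\<lambda>x. pr (lift \<phi> x))"
    by unfold_locales (auto simp: pr_def vec_eq_iff L.add L.scale lookup_add)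
  ultimately show ?thesis
    using assms(1)
    by (metis (no_types) linear_eqI[where s = "(*s)" and f = "\<lambda>x. pr (lift \<phi> x)" and g = \<phi>])
qed

theorem coderivation_unique:
  assumes \<theta>: "coderivation p \<theta>" and \<eta>: "coderivation p \<eta>" and pr: "\<And>x. pr (\<theta> x) = pr (\<eta> x)"
  shows "\<theta> x = \<eta> x"
proof -
  have z: "\<theta> (wb i0) = 0" "\<eta> (wb i0) = 0" and r: "Poly_Mapping.lookup (\<theta> x) i0 = 0"
    "Poly_Mapping.lookup (\<eta> x) i0 = 0" for x
    using \<theta> \<eta> unfolding coderivation_def by blast+
  have d: "coprod (\<zeta> x) =
        linext (\<lambda>(J, K). tens (\<zeta> (wb J)) (wb K)) (coprod x) +
        linext (\<lambda>(J, K). pscale (if p \<and> fst J then -1 else 1) (tens (wb J) (\<zeta> (wb K)))) (coprod x)"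
    if "coderivation p \<zeta>" for \<zeta> x
    using that unfolding coderivation_def by blast
  have "\<theta> (wb I) = \<eta> (wb I)" for I
  proof (induction "mdeg I" arbitrary: I rule: less_induct)
    case less
    have IH: "\<theta> (wb (msub I B)) = \<eta> (wb (msub I B))" if "B \<noteq> i0" "mle B I" for B
      by (rule less) (use that in \<open>cases I; cases B; auto simp: i0_def\<close>)
    have "coprod (\<theta> (wb I)) = coprod (\<eta> (wb I))"
      unfolding d[OF \<theta>] d[OF \<eta>]
      by (rule poly_mapping_eqI)
        (auto simp: lookup_add lookup_left lookup_right[where s = "\<lambda>J. if p \<and> fst J then -1 else 1"] z IH)
    then have c: "A \<noteq> i0 \<and> B \<noteq> i0 \<and> \<not> (fst A \<and> fst B) \<Longrightarrow>
        of_nat (mbinom A B) * Poly_Mapping.lookup (\<theta> (wb I)) (madd A B) =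
        of_nat (mbinom A B) * Poly_Mapping.lookup (\<eta> (wb I)) (madd A B)" for A B
      by (metis lookup_coprod)
    show ?case
    proof (rule poly_mapping_eqI)
      fix M :: midx
      obtain m1 m2 m3 where M: "M = (m1, m2, m3)" by (cases M)
      have p: "Poly_Mapping.lookup (\<theta> (wb I)) (j = 1, of_bool (j = 2), of_bool (j = 3))
          = Poly_Mapping.lookup (\<eta> (wb I)) (j = 1, of_bool (j = 2), of_bool (j = 3))" for j :: 3
        using pr[of "wb I"] by (simp add: pr_def vec_eq_iff)
      note p1 = p[of 1, simplified] and p2 = p[of 2, simplified] and p3 = p[of 3, simplified]
      show "Poly_Mapping.lookup (\<theta> (wb I)) M = Poly_Mapping.lookup (\<eta> (wb I)) M"
      proof (cases "mdeg M \<le> 1")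
        case True
        then have "M = i0 \<or> M = (True, 0, 0) \<or> M = (False, 1, 0) \<or> M = (False, 0, 1)"
          unfolding M by (cases m1) (auto simp: i0_def)
        then show ?thesis using p1 p2 p3 r by auto
      next
        case False
        consider "m1" "m2 > 0 \<or> m3 > 0" | "\<not> m1" "m2 > 0" | "\<not> m1" "m2 = 0" "m3 > 1"
          using False unfolding M by (cases m1) auto
        then show ?thesis
        proof cases
          case 1
          then show ?thesis using c[of "(True, 0, 0)" "(False, m2, m3)"] by (auto simp: M i0_def)
        next
          case 2
          then show ?thesis using c[of "(False, 1, 0)" "(False, m2 - 1, m3)"] False
            by (auto simp: M i0_def)
        next
          case 3
          then show ?thesis using c[of "(False, 0, 1)" "(False, 0, m3 - 1)"]
            by (auto simp: M i0_def)
        qed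
      qed
    qed
  qed
  then show ?thesis
    using linear_eqI[where s = pscale and f = \<theta> and g = \<eta>] \<theta> \<eta>
    unfolding coderivation_def by blast
qed

end

theory Submission
  imports Defs
begin

text \<open>
  Read cochains as vector fields in an odd coordinate \<open>\<theta>\<close> and even coordinates \<open>x\<close>, \<open>y\<close>, so that
  \<open>d\<^sub>c = \<theta>E\<close> with \<open>E = x\<partial>\<^sub>x + cy\<partial>\<^sub>y\<close>. For even vector fields \<open>X\<close>, \<open>Y\<close> and functions \<open>f\<close>, \<open>g\<close> of \<open>x\<close>, \<open>y\<close>,
  the coboundary sends, up to signs, \<open>X\<close> to \<open>\<theta>[E, X]\<close>, \<open>f\<partial>\<^sub>\<theta>\<close> to \<open>fE + \<theta>E(f)\<partial>\<^sub>\<theta>\<close>, \<open>\<theta>g\<partial>\<^sub>\<theta>\<close> to \<open>\<theta>gE\<close>, and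
  \<open>\<theta>Y\<close> to \<open>0\<close>. In degree at least \<open>2\<close> one may subtract multiples of \<open>E\<close> until the \<open>\<partial>\<^sub>x\<close>-part is free
  of \<open>x\<close>; what survives are the monomial fields commuting with \<open>E\<close>, namely \<open>y\<^sup>k\<partial>\<^sub>x\<close> with \<open>ck = 1\<close> and
  \<open>x\<^sup>iy\<^sup>k\<partial>\<^sub>y\<close> with \<open>i + ck = c\<close>, with and without the factor \<open>\<theta>\<close>. In degree \<open>1\<close> there is nothing
  to divide by, because \<open>L\<^sub>0 = 0\<close>.
\<close>

section \<open>The coboundary in coordinates\<close>

lemma linear_hpart:
  assumes "Vector_Spaces.linear pscale (*s) \<phi>"
  shows "Vector_Spaces.linear pscale (*s) (hpart p \<phi>)"
proof -
  interpret f: Vector_Spaces.linear pscale "(*s)" \<phi> by fact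
  interpret s: Vector_Spaces.linear pscale pscale "spart q" for q
    unfolding spart_def by (rule linear_linext)
  show ?thesis
    by unfold_locales
      (auto simp: hpart_def wpart_def UNIV_bool vec_eq_iff s.add f.add s.scale f.scale algebra_simps)
qed

lemma hpart_wb:
  assumes "Vector_Spaces.linear pscale (*s) \<phi>"
  shows "hpart p \<phi> (wb I) $ j = (if wpar j = (p \<noteq> fst I) then \<phi> (wb I) $ j else 0)"
proof -
  interpret f: Vector_Spaces.linear pscale "(*s)" \<phi> by fact
  show ?thesis
    by (auto simp: hpart_def spart_def linext_wb UNIV_bool wpart_def f.zero)
qed

lemma linear_phi: "Vector_Spaces.linear pscale (*s) (phi I j)"
  by unfold_locales (auto simp: phi_def vec_eq_iff lookup_add algebra_simps axis_def)

lemma phi_wb: "phi I j (wb J) $ l = (if J = I \<and> l = j then of_nat (mfact I) else 0)"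
  by (auto simp: phi_def lookup_wb axis_def)

lemma linear_dc: "Vector_Spaces.linear pscale (*s) (dc c)"
  by unfold_locales (auto simp: dc_def phi_def vec_eq_iff lookup_add algebra_simps axis_def)

lemma dc_nth:
  "dc c x $ 1 = 0" "dc c x $ 2 = Poly_Mapping.lookup x (True, 1, 0)"
  "dc c x $ 3 = c * Poly_Mapping.lookup x (True, 0, 1)"
  by (simp_all add: dc_def phi_def axis_def)

lemma hpart_dc: "hpart True (dc c) = dc c" "hpart False (dc c) = (\<lambda>_. 0)"
proof -
  have l0: "Vector_Spaces.linear pscale (*s) (\<lambda>_. 0 :: W)" by unfold_locales auto
  have "hpart p (dc c) (wb I) = (if p then dc c (wb I) else 0)" for p I
    by (cases p; cases I) (auto simp: vec_eq_iff forall_3 hpart_wb[OF linear_dc] wpar_def dc_nth lookup_wb)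
  then have *: "hpart True (dc c) (wb I) = dc c (wb I)" "hpart False (dc c) (wb I) = 0" for I
    by auto
  show "hpart True (dc c) = dc c" "hpart False (dc c) = (\<lambda>_. 0)"
    using linear_eqI[OF linear_hpart[OF linear_dc] linear_dc *(1)]
      linear_eqI[OF linear_hpart[OF linear_dc] l0 *(2)] by auto
qed

lemma lift_zero: "lift (\<lambda>_. 0) x = 0"
proof -
  have "wmul 0 K = 0" for K by (simp add: wmul_def)
  then show ?thesis by (simp add: lift_def linext_def case_prod_unfold)
qed

lemma linear_pr: "Vector_Spaces.linear pscale (*s) pr"
  by unfold_locales (auto simp: pr_def vec_eq_iff lookup_add)

text \<open>Dual to the action of \<open>\<theta>E\<close> on functions: \<open>w_1 w_2\<close> is
  replaced by \<open>w_2\<close> in \<open>i\<close> ways and \<open>w_1 w_3\<close> by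
  \<open>c w_3\<close> in \<open>k\<close> ways, so the factor is the \<open>E\<close>-weight of
  \<open>x^i y^k\<close>.\<close>

lemma lift_dc_wb:
  "lift (dc c) (wb (b, i, k)) = (if b then pscale (of_nat i + c * of_nat k) (wb (False, i, k)) else 0)"
proof (rule poly_mapping_eqI)
  fix M :: midx
  obtain m1 m2 m3 where M: "M = (m1, m2, m3)" by (cases M)
  \<comment> \<open>Truncated subtraction lets \<open>k - m3 = 0\<close> hold for
    \<open>k < m3\<close> too, but there the binomial coefficient is \<open>0\<close>. The surviving
    term has \<open>m2 = i\<close>, \<open>m3 = k\<close> and the count
    \<open>i choose (i - 1) = i\<close>.\<close>
  have A: "(if 0 < m2 then of_nat ((i choose (m2 - 1)) * (k choose m3)) *
        (if i - (m2 - 1) = 1 \<and> k - m3 = 0 then 1 else 0) else 0)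
      = (if m2 = i \<and> m3 = k then of_nat i else (0::complex))"
  proof -
    have "k = m3" if "k - m3 = 0" "(k choose m3) \<noteq> 0"
      using that by (metis binomial_eq_0_iff diff_is_0_eq le_antisym not_less)
    moreover have "i = m2" if "i - (m2 - 1) = 1" "0 < m2" using that by linarith
    moreover have "i choose (i - 1) = i" if "0 < i"
      using that by (metis One_nat_def Suc_leI binomial_symmetric choose_one)
    ultimately show ?thesis by auto
  qed
  have B: "(if 0 < m3 then of_nat ((i choose m2) * (k choose (m3 - 1))) *
        (c * (if i - m2 = 0 \<and> k - (m3 - 1) = 1 then 1 else 0)) else 0)
      = (if m2 = i \<and> m3 = k then c * of_nat k else (0::complex))"
  proof -
    have "i = m2" if "i - m2 = 0" "(i choose m2) \<noteq> 0"
      using that by (metis binomial_eq_0_iff diff_is_0_eq le_antisym not_less)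
    moreover have "k = m3" if "k - (m3 - 1) = 1" "0 < m3" using that by linarith
    moreover have "k choose (k - 1) = k" if "0 < k"
      using that by (metis One_nat_def Suc_leI binomial_symmetric choose_one)
    ultimately show ?thesis by auto
  qed
  have d: "dc c (wb (e, x, y)) $ 2 = (if e then if x = 1 \<and> y = 0 then 1 else 0 else 0)"
    "dc c (wb (e, x, y)) $ 3 = (if e then c * (if x = 0 \<and> y = 1 then 1 else 0) else 0)" for e x y
    by (auto simp: dc_nth lookup_wb)
  have "Poly_Mapping.lookup (lift (dc c) (wb (b, i, k))) (m1, m2, m3) =
      (if b \<and> \<not> m1 then (if m2 = i \<and> m3 = k then of_nat i else 0)
        + (if m2 = i \<and> m3 = k then c * of_nat k else 0) else 0)"
    unfolding lookup_lift d dc_nth(1) A[symmetric] B[symmetric]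
    by (cases b; cases m1) simp_all
  then show "Poly_Mapping.lookup (lift (dc c) (wb (b, i, k))) M = Poly_Mapping.lookup
     (if b then pscale (of_nat i + c * of_nat k) (wb (False, i, k)) else 0) M"
    by (auto simp: M lookup_wb)
qed

text \<open>As \<open>dc c\<close> is odd, only \<open>q = True\<close> contributes to the bracket,
  and the Koszul sign turns the minus into a plus on the odd part of \<open>\<phi>\<close>. The
  terms with \<open>\<phi>\<close> outside carry no sign, so there the parity components recombine
  to \<open>\<phi>\<close>.\<close>

lemma coboundary_eq_lift:
  assumes l: "Vector_Spaces.linear pscale (*s) \<phi>" and z: "\<phi> (wb i0) = 0"
  shows "coboundary (dc c) \<phi> x = \<phi> (lift (dc c) x)
      - dc c (lift (hpart False \<phi>) x) + dc c (lift (hpart True \<phi>) x)"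
proof -
  interpret p: Vector_Spaces.linear pscale "(*s)" pr by (rule linear_pr)
  interpret f: Vector_Spaces.linear pscale "(*s)" \<phi> by fact
  interpret h: Vector_Spaces.linear pscale "(*s)" "hpart p \<phi>" for p by (rule linear_hpart[OF l])
  have "hpart p \<phi> (wb i0) = 0" for p
    by (simp add: vec_eq_iff hpart_wb[OF l] z)
  then have 1: "pr (lift (hpart p \<phi>) x) = hpart p \<phi> x" for p x
    by (rule pr_lift[OF linear_hpart[OF l]])
  have 2: "pr (lift (dc c) x) = dc c x" for x
    by (rule pr_lift[OF linear_dc]) (simp add: vec_eq_iff forall_3 dc_nth lookup_wb i0_def)
  have lsum: "Vector_Spaces.linear pscale (*s) (\<lambda>x. hpart False \<phi> x + hpart True \<phi> x)"
    by unfold_locales (auto simp: h.add h.scale vec_eq_iff algebra_simps)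
  have 3: "hpart False \<phi> x + hpart True \<phi> x = \<phi> x" for x
    by (rule linear_eqI[OF lsum l]) (auto simp: vec_eq_iff hpart_wb[OF l])
  have "coboundary (dc c) \<phi> x = (hpart False \<phi> (lift (dc c) x) + hpart True \<phi> (lift (dc c) x))
      - dc c (lift (hpart False \<phi>) x) + dc c (lift (hpart True \<phi>) x)"
    by (simp add: coboundary_def bracket_def UNIV_bool hpart_dc lift_zero p.diff p.scale p.add 1 2
        p.zero p.neg h.zero)
  then show ?thesis by (simp only: 3)
qed

lemma linear_coboundary:
  assumes l: "Vector_Spaces.linear pscale (*s) \<phi>" and z: "\<phi> (wb i0) = 0"
  shows "Vector_Spaces.linear pscale (*s) (coboundary (dc c) \<phi>)"
proof -
  interpret f: Vector_Spaces.linear pscale "(*s)" \<phi> by fact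
  interpret d: Vector_Spaces.linear pscale "(*s)" "dc c" by (rule linear_dc)
  interpret L: Vector_Spaces.linear pscale pscale "lift \<psi>" for \<psi> by (rule linear_lift)
  show ?thesis
    by unfold_locales
      (simp_all add: coboundary_eq_lift[OF l z] f.add f.scale d.add d.scale L.add L.scale vec_eq_iff algebra_simps)
qed

text \<open>The value at \<open>w_I\<close> is \<open>I!\<close> times the coefficient of a
  monomial, so multiplication by \<open>x\<close> becomes a shift of \<open>i\<close> with factor
  \<open>i\<close>, which also makes the truncated \<open>i - 1\<close> harmless. On \<theta>-free
  monomials component 1 is \<open>f\<close> and components 2, 3 are \<open>X\<close>; on the others
  component 1 is \<open>g\<close>. The factors \<open>i + ck - 1\<close> and
  \<open>i + ck - c\<close> are the eigenvalues of \<open>[E, _]\<close>.\<close>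

lemma coboundary_wb:
  assumes l: "Vector_Spaces.linear pscale (*s) \<phi>" and z: "\<phi> (wb i0) = 0"
  shows "coboundary (dc c) \<phi> (wb (False, i, k)) $ 1 = 0"
    "coboundary (dc c) \<phi> (wb (False, i, k)) $ 2 = of_nat i * \<phi> (wb (False, i - 1, k)) $ 1"
    "coboundary (dc c) \<phi> (wb (False, i, k)) $ 3 = c * of_nat k * \<phi> (wb (False, i, k - 1)) $ 1"
    "coboundary (dc c) \<phi> (wb (True, i, k)) $ 1 =
       (of_nat i + c * of_nat k) * \<phi> (wb (False, i, k)) $ 1"
    "coboundary (dc c) \<phi> (wb (True, i, k)) $ 2 =
       (of_nat i + c * of_nat k - 1) * \<phi> (wb (False, i, k)) $ 2 - of_nat i * \<phi> (wb (True, i - 1, k)) $ 1"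
    "coboundary (dc c) \<phi> (wb (True, i, k)) $ 3 =
       (of_nat i + c * of_nat k - c) * \<phi> (wb (False, i, k)) $ 3 - c * of_nat k * \<phi> (wb (True, i, k - 1)) $ 1"
proof -
  interpret f: Vector_Spaces.linear pscale "(*s)" \<phi> by fact
  note s = coboundary_eq_lift[OF l z] lift_dc_wb f.add f.scale f.zero dc_nth lookup_lift hpart_wb[OF l] wpar_def
  show "coboundary (dc c) \<phi> (wb (False, i, k)) $ 1 = 0"
    "coboundary (dc c) \<phi> (wb (False, i, k)) $ 2 = of_nat i * \<phi> (wb (False, i - 1, k)) $ 1"
    "coboundary (dc c) \<phi> (wb (False, i, k)) $ 3 = c * of_nat k * \<phi> (wb (False, i, k - 1)) $ 1"
    "coboundary (dc c) \<phi> (wb (True, i, k)) $ 1 =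
       (of_nat i + c * of_nat k) * \<phi> (wb (False, i, k)) $ 1"
    "coboundary (dc c) \<phi> (wb (True, i, k)) $ 2 =
       (of_nat i + c * of_nat k - 1) * \<phi> (wb (False, i, k)) $ 2 - of_nat i * \<phi> (wb (True, i - 1, k)) $ 1"
    "coboundary (dc c) \<phi> (wb (True, i, k)) $ 3 =
       (of_nat i + c * of_nat k - c) * \<phi> (wb (False, i, k)) $ 3 - c * of_nat k * \<phi> (wb (True, i, k - 1)) $ 1"
    by (simp_all add: s algebra_simps)
qed

section \<open>A dual-functional criterion for bases of cohomology\<close>

definition fsubspace :: "(sym \<Rightarrow> W) set \<Rightarrow> bool" where
  "fsubspace S \<longleftrightarrow> (\<lambda>_. 0) \<in> S \<and> (\<forall>a. \<forall>\<phi>\<in>S. \<forall>\<psi>\<in>S. (\<lambda>x. a *s \<phi> x + \<psi> x) \<in> S)"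

definition flinear :: "((sym \<Rightarrow> W) \<Rightarrow> complex) \<Rightarrow> bool" where
  "flinear \<rho> \<longleftrightarrow> (\<forall>a \<phi> \<psi>. \<rho> (\<lambda>x. a *s \<phi> x + \<psi> x) = a * \<rho> \<phi> + \<rho> \<psi>)"

lemma fsubspace_comb:
  assumes "fsubspace S" "\<phi> \<in> S" "\<psi> \<in> S"
  shows "(\<lambda>x. a *s \<phi> x + \<psi> x) \<in> S"
  using assms unfolding fsubspace_def by simp

lemma fsubspace_diff:
  assumes "fsubspace S" "\<phi> \<in> S" "\<psi> \<in> S"
  shows "(\<lambda>x. \<phi> x - \<psi> x) \<in> S"
  using fsubspace_comb[OF assms(1,3,2), of "-1"] by simp

lemma fsubspace_add:
  assumes "fsubspace S" "\<phi> \<in> S" "\<psi> \<in> S"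
  shows "(\<lambda>x. \<phi> x + \<psi> x) \<in> S"
  using fsubspace_comb[OF assms, of 1] by simp

lemma fsubspace_sum:
  assumes "fsubspace S" "\<And>i. i < (N::nat) \<Longrightarrow> f i \<in> S"
  shows "(\<lambda>x. \<Sum>i<N. a i *s f i x) \<in> S"
  using assms(2)
proof (induction N)
  case 0
  show ?case using assms(1) by (simp add: fsubspace_def)
next
  case (Suc N)
  then have "(\<lambda>x. a N *s f N x + (\<Sum>i<N. a i *s f i x)) \<in> S"
    by (intro fsubspace_comb[OF assms(1)]) simp_all
  then show ?case by (simp add: add.commute)
qed

lemma flinear_comb:
  assumes "flinear \<rho>"
  shows "\<rho> (\<lambda>x. a *s \<phi> x + \<psi> x) = a * \<rho> \<phi> + \<rho> \<psi>"
  using assms unfolding flinear_def by (elim allE)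

lemma flinear_zero:
  assumes "flinear \<rho>" shows "\<rho> (\<lambda>_. 0) = 0"
  using flinear_comb[OF assms, of "-1" "\<lambda>_. 0" "\<lambda>_. 0"] by simp

lemma flinear_sum:
  assumes "flinear \<rho>"
  shows "\<rho> (\<lambda>x. \<Sum>i<(N::nat). a i *s f i x) = (\<Sum>i<N. a i * \<rho> (f i))"
proof (induction N)
  case (Suc N)
  show ?case
    using flinear_comb[OF assms, of "a N" "f N" "\<lambda>x. \<Sum>i<N. a i *s f i x"] Suc
    by (simp add: add.commute)
qed (simp add: flinear_zero[OF assms])

lemma flinear_diff:
  assumes "flinear \<rho>"
  shows "\<rho> (\<lambda>x. \<phi> x - \<psi> x) = \<rho> \<phi> - \<rho> \<psi>"
  using flinear_comb[OF assms, of "-1" \<psi> \<phi>] by simp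

section \<open>Cochains, cocycles and coboundaries as subspaces\<close>

lemma fsubspace_Lsp: "fsubspace (Lsp n)"
  unfolding fsubspace_def
proof safe
  show "(\<lambda>_. 0) \<in> Lsp n" unfolding Lsp_def by (auto intro!: Vector_Spaces.linear.intro) (unfold_locales, auto)
next
  fix a \<phi> \<psi> assume A: "\<phi> \<in> Lsp n" "\<psi> \<in> Lsp n"
  interpret f: Vector_Spaces.linear pscale "(*s)" \<phi> using A by (simp add: Lsp_def)
  interpret g: Vector_Spaces.linear pscale "(*s)" \<psi> using A by (simp add: Lsp_def)
  have "Vector_Spaces.linear pscale (*s) (\<lambda>x. a *s \<phi> x + \<psi> x)"
    by unfold_locales (simp_all add: f.add f.scale g.add g.scale vec_eq_iff algebra_simps)
  then show "(\<lambda>x. a *s \<phi> x + \<psi> x) \<in> Lsp n" using A by (simp add: Lsp_def)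
qed

lemma LspD:
  assumes "\<phi> \<in> Lsp n"
  shows "Vector_Spaces.linear pscale (*s) \<phi>" "\<phi> (wb i0) = 0"
    "mdeg I \<noteq> n \<or> n = 0 \<Longrightarrow> \<phi> (wb I) = 0"
  using assms by (cases I; simp add: Lsp_def i0_def)+

text \<open>Both sides are linear in \<open>x\<close>, and on basis monomials
  \<open>coboundary_wb\<close> expresses the coboundary linearly in the coefficients of the
  cochain.\<close>

lemma coboundary_lincomb:
  assumes "\<phi> \<in> Lsp n" "\<psi> \<in> Lsp n"
  shows "coboundary (dc c) (\<lambda>x. a *s \<phi> x + \<psi> x)
    = (\<lambda>x. a *s coboundary (dc c) \<phi> x + coboundary (dc c) \<psi> x)"
proof -
  have A: "(\<lambda>x. a *s \<phi> x + \<psi> x) \<in> Lsp n" by (rule fsubspace_comb[OF fsubspace_Lsp assms])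
  note l = LspD[OF assms(1)] LspD[OF assms(2)] LspD[OF A]
  interpret f: Vector_Spaces.linear pscale "(*s)" "coboundary (dc c) \<phi>" by (rule linear_coboundary[OF l(1,2)])
  interpret g: Vector_Spaces.linear pscale "(*s)" "coboundary (dc c) \<psi>" by (rule linear_coboundary[OF l(4,5)])
  have L: "Vector_Spaces.linear pscale (*s) (\<lambda>x. a *s coboundary (dc c) \<phi> x + coboundary (dc c) \<psi> x)"
    by unfold_locales (simp_all add: f.add f.scale g.add g.scale vec_eq_iff algebra_simps)
  define \<eta> where "\<eta> = (\<lambda>x. a *s \<phi> x + \<psi> x)"
  have "coboundary (dc c) \<eta> (wb I)
    = a *s coboundary (dc c) \<phi> (wb I) + coboundary (dc c) \<psi> (wb I)" for I
  proof -
    obtain b i k where I: "I = (b, i, k)" by (cases I)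
    have e: "\<eta> x = a *s \<phi> x + \<psi> x" for x by (simp add: \<eta>_def)
    show ?thesis
      unfolding I by (cases b) (simp_all add: vec_eq_iff forall_3 coboundary_wb[OF l(1,2)]
        coboundary_wb[OF l(4,5)] coboundary_wb[OF l(7,8), folded \<eta>_def] e algebra_simps)
  qed
  then show ?thesis
    using linear_eqI[OF linear_coboundary[OF l(7,8), folded \<eta>_def] L] unfolding \<eta>_def by blast
qed

lemma coboundary_zero: "coboundary (dc c) (\<lambda>_. 0) = (\<lambda>_. 0)"
  using coboundary_lincomb[of "\<lambda>_. 0" 0 "\<lambda>_. 0" c "-1"] fsubspace_Lsp[of 0]
  by (simp add: fsubspace_def)

lemma fsubspace_cocycles: "fsubspace (cocycles (dc c) n)"
  using fsubspace_Lsp[of n] unfolding fsubspace_def cocycles_def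
  by (auto simp: coboundary_zero coboundary_lincomb)

lemma fsubspace_coboundaries: "fsubspace (coboundaries (dc c) n)"
  unfolding fsubspace_def
proof (intro conjI allI ballI)
  note S = fsubspace_Lsp[of "n - 1", unfolded fsubspace_def]
  show "(\<lambda>_. 0) \<in> coboundaries (dc c) n"
    unfolding coboundaries_def using S
    by (intro image_eqI[where x = "\<lambda>_. 0"]) (simp_all add: coboundary_zero)
  show "(\<lambda>x. a *s \<phi> x + \<psi> x) \<in> coboundaries (dc c) n"
    if AB: "\<phi> \<in> coboundaries (dc c) n" "\<psi> \<in> coboundaries (dc c) n" for a \<phi> \<psi>
  proof -
    obtain \<phi>' \<psi>' where "\<phi>' \<in> Lsp (n - 1)" "\<phi> = coboundary (dc c) \<phi>'"
      "\<psi>' \<in> Lsp (n - 1)" "\<psi> = coboundary (dc c) \<psi>'"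
      using AB by (auto simp: coboundaries_def)
    then show ?thesis
      unfolding coboundaries_def using S
      by (intro image_eqI[where x = "\<lambda>x. a *s \<phi>' x + \<psi>' x"]) (simp_all add: coboundary_lincomb)
  qed
qed

lemma equiv_cohomologous: "equiv (cocycles (dc c) n) (cohomologous (dc c) n)"
proof (rule equivI)
  note S = fsubspace_coboundaries[of c n]
  have Z: "(\<lambda>_. 0) \<in> coboundaries (dc c) n" using S by (simp add: fsubspace_def)
  show "cohomologous (dc c) n \<subseteq> cocycles (dc c) n \<times> cocycles (dc c) n"
    by (auto simp: cohomologous_def)
  show "refl_on (cocycles (dc c) n) (cohomologous (dc c) n)"
    using Z by (auto simp: refl_on_def cohomologous_def)
  show "sym (cohomologous (dc c) n)"
    using fsubspace_diff[OF S Z] by (fastforce simp: sym_def cohomologous_def)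
  show "trans (cohomologous (dc c) n)"
    using fsubspace_add[OF S] by (fastforce simp: trans_def cohomologous_def)
qed

text \<open>The functionals \<open>\<rho> i\<close> descend to cohomology, jointly separate classes
  there, and are dual to \<open>bs\<close> up to nonzero scalars. The scalars are left free because
  \<open>phi I j\<close> carries the factor \<open>I!\<close>.\<close>

lemma cohomology_basisI:
  assumes cocycle: "set bs \<subseteq> cocycles (dc c) n"
    and linear: "\<And>i. flinear (\<rho> i)"
    and dual: "\<And>i j. \<lbrakk>i < length bs; j < length bs\<rbrakk> \<Longrightarrow> \<rho> i (bs ! j) = 0 \<longleftrightarrow> i \<noteq> j"
    and vanish: "\<And>i \<phi>. \<lbrakk>i < length bs; \<phi> \<in> coboundaries (dc c) n\<rbrakk> \<Longrightarrow> \<rho> i \<phi> = 0"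
    and exact: "\<And>\<phi>. \<lbrakk>\<phi> \<in> cocycles (dc c) n; \<And>i. i < length bs \<Longrightarrow> \<rho> i \<phi> = 0\<rbrakk>
                  \<Longrightarrow> \<phi> \<in> coboundaries (dc c) n"
  shows "cohomology_basis (dc c) n bs"
  unfolding cohomology_basis_def cohomology_def
proof (intro conjI ballI cocycle)
  let ?R = "cohomologous (dc c) n"
  let ?s = "\<lambda>a x. \<Sum>i<length bs. (a ! i) *s (bs ! i) x"
  have comb: "?s a \<in> cocycles (dc c) n" for a
    using cocycle by (intro fsubspace_sum[OF fsubspace_cocycles]) auto
  have \<rho>: "\<rho> i (?s a) = a ! i * \<rho> i (bs ! i)" if "i < length bs" for i and a :: "complex list"
  proof -
    have "\<rho> i (?s a) = (\<Sum>j<length bs. a ! j * \<rho> i (bs ! j))" by (rule flinear_sum[OF linear])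
    also have "\<dots> = (\<Sum>j<length bs. if j = i then a ! i * \<rho> i (bs ! i) else 0)"
    proof (intro sum.cong refl)
      fix j assume "j \<in> {..<length bs}"
      then show "a ! j * \<rho> i (bs ! j) = (if j = i then a ! i * \<rho> i (bs ! i) else 0)"
        using dual[OF that, of j] by (cases "j = i") simp_all
    qed
    finally show ?thesis using that by (simp add: sum.delta)
  qed
  fix h assume "h \<in> cocycles (dc c) n // ?R"
  then obtain \<phi> where \<phi>: "\<phi> \<in> cocycles (dc c) n" "h = ?R `` {\<phi>}" by (auto elim: quotientE)
  have cls: "h = ?R `` {?s a} \<longleftrightarrow> (\<lambda>x. \<phi> x - ?s a x) \<in> coboundaries (dc c) n" for a
    unfolding \<phi>(2) eq_equiv_class_iff[OF equiv_cohomologous \<phi>(1) comb]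
    using \<phi>(1) comb[of a] by (simp only: cohomologous_def mem_Collect_eq case_prod_conv simp_thms)
  \<comment> \<open>Being exact amounts to one scalar equation per basis element, each with exactly
    one solution since \<open>\<rho> i (bs ! i)\<close> is nonzero.\<close>
  have crit: "h = ?R `` {?s a} \<longleftrightarrow> (\<forall>i<length bs. a ! i = \<rho> i \<phi> / \<rho> i (bs ! i))" for a
  proof -
    have "(\<lambda>x. \<phi> x - ?s a x) \<in> coboundaries (dc c) n \<longleftrightarrow> (\<forall>i<length bs. \<rho> i (\<lambda>x. \<phi> x - ?s a x) = 0)"
      using vanish[of _ "\<lambda>x. \<phi> x - ?s a x"] exact[of "\<lambda>x. \<phi> x - ?s a x"]
        fsubspace_diff[OF fsubspace_cocycles \<phi>(1) comb, of a] by iprover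
    also have "\<dots> \<longleftrightarrow> (\<forall>i<length bs. a ! i = \<rho> i \<phi> / \<rho> i (bs ! i))"
    proof (intro all_cong)
      fix i assume i: "i < length bs"
      have "\<rho> i (\<lambda>x. \<phi> x - ?s a x) = \<rho> i \<phi> - a ! i * \<rho> i (bs ! i)"
        unfolding flinear_diff[OF linear] \<rho>[OF i] ..
      then show "\<rho> i (\<lambda>x. \<phi> x - ?s a x) = 0 \<longleftrightarrow> a ! i = \<rho> i \<phi> / \<rho> i (bs ! i)"
        using dual[OF i i] by (simp only: eq_divide_eq) auto
    qed
    finally show ?thesis by (simp only: cls)
  qed
  show "\<exists>!a::complex list. length a = length bs \<and> h = ?R `` {?s a}"
  proof (rule ex1I)
    show "length (map (\<lambda>i. \<rho> i \<phi> / \<rho> i (bs ! i)) [0..<length bs]) = length bs \<and>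
        h = ?R `` {?s (map (\<lambda>i. \<rho> i \<phi> / \<rho> i (bs ! i)) [0..<length bs])}"
      unfolding crit by simp
    show "a = map (\<lambda>i. \<rho> i \<phi> / \<rho> i (bs ! i)) [0..<length bs]"
      if "length a = length bs \<and> h = ?R `` {?s a}" for a
      using that unfolding crit by (intro nth_equalityI) auto
  qed
qed

section \<open>Reduced coefficients\<close>

text \<open>Fields \<open>\<theta>Y\<close> are always closed; a \<theta>-free monomial field is
  closed when its eigenvalue under \<open>[E, _]\<close> is \<open>0\<close>.\<close>

lemma phi_in_cocycles:
  assumes n: "mdeg (b, i, k) = n" "0 < n"
    and w: "b \<or> (j = 2 \<and> of_nat i + c * of_nat k = 1) \<or> (j = 3 \<and> of_nat i + c * of_nat k = c)"
    and j: "j \<noteq> 1"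
  shows "phi (b, i, k) j \<in> cocycles (dc c) n"
proof -
  define f where "f = phi (b, i, k) j"
  have L: "f \<in> Lsp n"
    using n by (auto simp: f_def Lsp_def linear_phi vec_eq_iff phi_wb)
  note l = LspD[OF L]
  have l0: "Vector_Spaces.linear pscale (*s) (\<lambda>_. 0 :: W)" by unfold_locales auto
  have "coboundary (dc c) f (wb I) = 0" for I
  proof -
    obtain e x y where I: "I = (e, x, y)" by (cases I)
    have f: "f (wb (a, x, y)) $ m =
        (if (a \<longleftrightarrow> b) \<and> x = i \<and> y = k \<and> m = j then of_nat (mfact (b, i, k)) else 0)" for a x y m
      by (simp add: f_def phi_wb)
    have j1: "(1::3) = j \<longleftrightarrow> False" using j by auto
    show ?thesis
      unfolding I using w
      by (cases e) (auto simp: vec_eq_iff forall_3 coboundary_wb[OF l(1,2)] f j1)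
  qed
  then have "coboundary (dc c) f = (\<lambda>_. 0)"
    using linear_eqI[OF linear_coboundary[OF l(1,2)] l0] by blast
  then show ?thesis using L by (simp add: cocycles_def f_def)
qed

text \<open>The \<open>\<partial>\<^sub>x\<close>-part of \<open>fE\<close> is \<open>xf\<close>,
  whose vanishing forces \<open>f = 0\<close>; hence the shift to \<open>Suc i\<close>, where the
  factor is nonzero. The other two equations say that \<open>[E, X]\<close> and \<open>gE\<close>
  cancel.\<close>

lemma cocycle_coeffs:
  assumes "\<phi> \<in> cocycles (dc c) n"
  shows "\<phi> (wb (False, i, k)) $ 1 = 0"
    "(of_nat i + c * of_nat k - 1) * \<phi> (wb (False, i, k)) $ 2 = of_nat i * \<phi> (wb (True, i - 1, k)) $ 1"
    "(of_nat i + c * of_nat k - c) * \<phi> (wb (False, i, k)) $ 3 = c * of_nat k * \<phi> (wb (True, i, k - 1)) $ 1"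
proof -
  have L: "\<phi> \<in> Lsp n" and D: "coboundary (dc c) \<phi> x = 0" for x
    using assms by (auto simp: cocycles_def)
  note w = coboundary_wb[OF LspD(1,2)[OF L], of c, unfolded D, simplified]
  show "\<phi> (wb (False, i, k)) $ 1 = 0" using w(2)[of "Suc i" k] by (simp flip: of_nat_Suc)
  show "(of_nat i + c * of_nat k - 1) * \<phi> (wb (False, i, k)) $ 2 = of_nat i * \<phi> (wb (True, i - 1, k)) $ 1"
    using w(5)[of i k] by simp
  show "(of_nat i + c * of_nat k - c) * \<phi> (wb (False, i, k)) $ 3 = c * of_nat k * \<phi> (wb (True, i, k - 1)) $ 1"
    using w(6)[of i k] by simp
qed

text \<open>\<open>linext\<close> takes values in finitely supported functions, so the values in
  \<open>W\<close> are embedded as degree 1 elements by multiplying with \<open>w_0 = 1\<close>, and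
  \<open>pr\<close> reads them back.\<close>

definition from_coeffs :: "(midx \<Rightarrow> W) \<Rightarrow> sym \<Rightarrow> W" where
  "from_coeffs h x = pr (linext (\<lambda>I. wmul (h I) i0) x)"

lemma from_coeffs_wb: "from_coeffs h (wb I) = h I"
  by (simp add: from_coeffs_def linext_wb vec_eq_iff forall_3 pr_def lookup_wmul i0_def)

lemma from_coeffs_in_Lsp:
  assumes "\<And>I. mdeg I \<noteq> n \<or> n = 0 \<Longrightarrow> h I = 0"
  shows "from_coeffs h \<in> Lsp n"
proof -
  interpret p: Vector_Spaces.linear pscale "(*s)" pr by (rule linear_pr)
  interpret l: Vector_Spaces.linear pscale pscale "linext g" for g :: "midx \<Rightarrow> sym" by (rule linear_linext)
  have "Vector_Spaces.linear pscale (*s) (from_coeffs h)"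
    by unfold_locales (simp_all add: from_coeffs_def p.add p.scale l.add l.scale)
  then show ?thesis using assms by (simp add: Lsp_def from_coeffs_wb)
qed

text \<open>
  The coefficients after subtracting the multiple of \<open>E\<close> that removes all multiples of \<open>x\<close> from the
  \<open>\<partial>\<^sub>x\<close>-part. For \<open>k = 0\<close> the truncated \<open>k - 1\<close> is harmless since its term has the factor \<open>k\<close>.
\<close>

fun reduced_coeff :: "complex \<Rightarrow> midx \<times> 3 \<Rightarrow> (sym \<Rightarrow> W) \<Rightarrow> complex" where
  "reduced_coeff c ((b, i, k), j) \<phi> = \<phi> (wb (b, i, k)) $ j
     - (if j = 3 then c * of_nat k / of_nat (i + 1) * \<phi> (wb (b, i + 1, k - 1)) $ 2 else 0)"

definition basis_index :: "complex \<Rightarrow> nat \<Rightarrow> (midx \<times> 3) set" where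
  "basis_index c n = {((b, i, k), j) | b i k j. mdeg (b, i, k) = n \<and>
     (j = 2 \<and> i = 0 \<and> c * of_nat k = 1 \<or> j = 3 \<and> of_nat i + c * of_nat k = c)}"

lemma index_cases:
  fixes p :: "midx \<times> 3"
  obtains b i k j where "p = ((b, i, k), j)"
  by (cases p; cases "fst p") auto

lemma flinear_reduced_coeff: "flinear (reduced_coeff c p)"
proof -
  obtain b i k j where "p = ((b, i, k), j)" by (rule index_cases)
  then show ?thesis by (simp add: flinear_def algebra_simps)
qed

text \<open>The correction term only sees \<open>\<partial>\<^sub>x\<close>-coefficients with a
  positive power of \<open>x\<close>, while the fields \<open>j = 2\<close> in the index set are
  free of \<open>x\<close>.\<close>

lemma reduced_coeff_phi:
  assumes "p \<in> basis_index c n" "q \<in> basis_index c n"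
  shows "reduced_coeff c p (phi (fst q) (snd q)) = 0 \<longleftrightarrow> p \<noteq> q"
proof -
  obtain b i k j where p: "p = ((b, i, k), j)" by (rule index_cases)
  obtain b' i' k' j' where q: "q = ((b', i', k'), j')" by (rule index_cases)
  have "j' = 2 \<Longrightarrow> i' = 0" using assms(2) by (force simp: q basis_index_def)
  then have "phi (b', i', k') j' (wb (b, i + 1, k - 1)) $ 2 = 0" by (auto simp: phi_wb)
  then have "reduced_coeff c p (phi (b', i', k') j') =
      (if p = q then of_nat (mfact (b, i, k)) else 0)"
    by (simp add: p q phi_wb)
  then show ?thesis by (simp add: q)
qed

text \<open>At these indices the \<open>[E, X]\<close>-part has eigenvalue \<open>0\<close>. What
  remains is a multiple of \<open>E\<close>, whose \<open>\<partial>\<^sub>x\<close>-part has no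
  \<open>x\<close>-free terms and whose \<open>\<partial>\<^sub>y\<close>-part is exactly the
  correction term.\<close>

lemma reduced_coeff_coboundary:
  assumes \<phi>: "\<phi> \<in> coboundaries (dc c) n" and p: "p \<in> basis_index c n"
  shows "reduced_coeff c p \<phi> = 0"
proof -
  obtain \<eta> where \<eta>: "\<eta> \<in> Lsp (n - 1)" "\<phi> = coboundary (dc c) \<eta>"
    using \<phi> by (auto simp: coboundaries_def)
  note w = coboundary_wb[OF LspD(1,2)[OF \<eta>(1)]]
  obtain b i k j where pq: "p = ((b, i, k), j)" by (rule index_cases)
  have nz: "1 + of_nat i \<noteq> (0::complex)" by (metis of_nat_Suc of_nat_eq_0_iff nat.simps(3))
  consider "j = 2" "i = 0" "c * of_nat k = 1" | "j = 3" "of_nat i + c * of_nat k = c"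
    using p unfolding pq basis_index_def by auto
  then show ?thesis
  proof cases
    case 1
    then show ?thesis by (cases b) (simp_all add: pq \<eta>(2) w)
  next
    case 2
    show ?thesis
    proof (cases k)
      case 0
      then show ?thesis using 2 by (cases b) (simp_all add: pq \<eta>(2) w)
    next
      case (Suc k')
      then have e: "of_nat i + c * of_nat k' = 0" using 2 by (simp add: algebra_simps)
      \<comment> \<open>The correction term reads the field
        \<open>x^(i+1) y^(k-1) \<partial>\<^sub>x\<close>, which has the same eigenvalue under
        \<open>[E, _]\<close>, so its \<open>[E, X]\<close>-part vanishes as well.\<close>
      have s: "of_nat (Suc i) + c * of_nat k' - 1 = 0" using e by simp
      show ?thesis
        using 2 nz unfolding pq \<eta>(2) reduced_coeff.simps
        by (cases b) (simp_all add: w s Suc field_simps del: of_nat_Suc)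
    qed
  qed
qed

text \<open>A multiple of \<open>E\<close> accounts for the part divisible by \<open>x\<close>. Of
  the rest, the \<theta>-free part is \<open>0\<close> by closedness, and the \<theta>-part is
  \<open>\<theta>[E, X]\<close> with \<open>X\<close> found by dividing by eigenvalues. The bound
  \<open>2 \<le> n\<close> puts the primitive in a degree at least 1.\<close>

lemma coboundary_if_reduced_coeff_0:
  assumes n: "2 \<le> n" and \<phi>: "\<phi> \<in> cocycles (dc c) n"
    and r: "\<And>p. p \<in> basis_index c n \<Longrightarrow> reduced_coeff c p \<phi> = 0"
  shows "\<phi> \<in> coboundaries (dc c) n"
proof -
  have L: "\<phi> \<in> Lsp n" using \<phi> by (simp add: cocycles_def)
  note Z = LspD(3)[OF L] and coeffs = cocycle_coeffs[OF \<phi>]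
  have nz: "1 + of_nat i \<noteq> (0::complex)" for i by (metis of_nat_Suc of_nat_eq_0_iff nat.simps(3))
  have r2: "\<phi> (wb (b, 0, k)) $ 2 = 0" if "c * of_nat k = 1" for b k
  proof (cases "mdeg (b, 0, k) = n")
    case True
    then show ?thesis using r[of "((b, 0, k), 2)"] that by (simp add: basis_index_def)
  qed (simp add: Z)
  \<comment> \<open>The reduced \<open>\<partial>\<^sub>y\<close>-coefficient at every exponent,
    including those outside \<open>basis_index\<close>.\<close>
  define t where "t b i k = \<phi> (wb (b, i, k)) $ 3
      - c * of_nat k / of_nat (i + 1) * \<phi> (wb (b, i + 1, k - 1)) $ 2" for b i k
  have tZ: "t b i k = 0" if "mdeg (b, i, k) \<noteq> n" for b i k
    using that by (cases k) (simp_all add: t_def Z)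
  have r3: "t b i k = 0" if "of_nat i + c * of_nat k = c" for b i k
  proof (cases "mdeg (b, i, k) = n")
    case True
    then show ?thesis using r[of "((b, i, k), 3)"] that by (simp add: basis_index_def t_def)
  qed (rule tZ)
  \<comment> \<open>The primitive: \<open>h\<close> divides the \<open>\<partial>\<^sub>x\<close>-part by \<open>x\<close> and the remaining fields by their \<open>E\<close>-weight. Where
    the weight is \<open>0\<close> the numerator vanishes too, so the value \<open>0\<close> of the division is the right one.\<close>
  define h :: "midx \<Rightarrow> W" where "h = (\<lambda>(b, i, k). vector
     (if b then [- \<phi> (wb (True, i + 1, k)) $ 2 / of_nat (i + 1), 0, 0]
      else [\<phi> (wb (False, i + 1, k)) $ 2 / of_nat (i + 1),
            if i = 0 then \<phi> (wb (True, 0, k)) $ 2 / (c * of_nat k - 1) else 0,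
            t True i k / (of_nat i + c * of_nat k - c)]))"
  have h: "h (True, i, k) $ 1 = - \<phi> (wb (True, i + 1, k)) $ 2 / of_nat (i + 1)"
    "h (False, i, k) $ 1 = \<phi> (wb (False, i + 1, k)) $ 2 / of_nat (i + 1)"
    "h (False, i, k) $ 2 = (if i = 0 then \<phi> (wb (True, 0, k)) $ 2 / (c * of_nat k - 1) else 0)"
    "h (False, i, k) $ 3 = t True i k / (of_nat i + c * of_nat k - c)"
    "h (True, i, k) $ 2 = 0" "h (True, i, k) $ 3 = 0" for i k
    by (simp_all add: h_def)
  have H: "from_coeffs h \<in> Lsp (n - 1)"
  proof (rule from_coeffs_in_Lsp)
    fix I assume I: "mdeg I \<noteq> n - 1 \<or> n - 1 = 0"
    obtain b i k where [simp]: "I = (b, i, k)" by (cases I)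
    show "h I = 0"
      using I n by (cases b) (auto simp: vec_eq_iff forall_3 h Z tZ)
  qed
  note w = coboundary_wb[OF LspD(1,2)[OF H]]
  \<comment> \<open>The cocycle equations for the \<open>\<partial>\<^sub>x\<close>- and
    \<open>\<partial>\<^sub>y\<close>-parts involve the same coefficient of \<open>g\<close>;
    eliminating it leaves the eigenvalue times \<open>t\<close>.\<close>
  have F3: "t False i k = 0" for i k
  proof (cases "of_nat i + c * of_nat k = c")
    case False
    have "(of_nat i + c * of_nat k - c) * t False i k = 0"
    proof (cases k)
      case 0
      then show ?thesis using coeffs(3)[of i k] by (simp add: t_def)
    next
      case (Suc k')
      have "(of_nat i + c * of_nat k - c) * \<phi> (wb (False, i + 1, k')) $ 2 = of_nat (i + 1) * \<phi> (wb (True, i, k')) $ 1"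
        using coeffs(2)[of "i + 1" k'] Suc by (simp add: algebra_simps)
      then show ?thesis
        using coeffs(3)[of i k] nz[of i] Suc by (simp add: t_def field_simps)
    qed
    then show ?thesis using False by simp
  qed (rule r3)
  have T3: "t True i k = (of_nat i + c * of_nat k - c) * h (False, i, k) $ 3" for i k
    using r3[of i k True] by (cases "of_nat i + c * of_nat k = c") (simp_all add: h)
  have "coboundary (dc c) (from_coeffs h) (wb I) = \<phi> (wb I)" for I
  proof -
    obtain b i k where I: "I = (b, i, k)" by (cases I)
    have F2: "\<phi> (wb (False, 0, k)) $ 2 = 0"
      using coeffs(2)[of 0 k] r2[of k False] by auto
    \<comment> \<open>This matches the \<open>\<partial>\<^sub>\<theta>\<close>-part: with
      \<open>f\<close> obtained by dividing the \<open>\<partial>\<^sub>x\<close>-part by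
      \<open>x\<close>, the term \<open>E(f)\<close> is the one already present in
      \<open>\<phi>\<close>.\<close>
    have F1: "(of_nat i + c * of_nat k) * \<phi> (wb (False, i + 1, k)) $ 2 = of_nat (i + 1) * \<phi> (wb (True, i, k)) $ 1"
      using coeffs(2)[of "i + 1" k] by simp
    have T2: "\<phi> (wb (True, 0, k)) $ 2 = (c * of_nat k - 1) * h (False, 0, k) $ 2"
      using r2[of k True] by (cases "c * of_nat k = 1") (simp_all add: h)
    show ?thesis
    proof (cases b)
      case True
      then show ?thesis
        unfolding I using F1 T2 T3[of i k] nz[of i] nz[of "i - 1"]
        by (cases i) (simp_all add: vec_eq_iff forall_3 w from_coeffs_wb h(1,2) h(3)[of "Suc _"] t_def field_simps)
    next
      case False
      then show ?thesis
        unfolding I using F2 F3[of i k] nz[of i] nz[of "i - 1"]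
        by (cases i) (simp_all add: vec_eq_iff forall_3 w from_coeffs_wb h(1,2) coeffs(1) t_def field_simps)
    qed
  qed
  then have "coboundary (dc c) (from_coeffs h) = \<phi>"
    using linear_eqI[OF linear_coboundary[OF LspD(1,2)[OF H]] LspD(1)[OF L]] by blast
  then show ?thesis using H by (auto simp: coboundaries_def)
qed

text \<open>Only the solution set of the weight equations is left to determine. \<open>ps\<close> is
  any enumeration of it, so each case can list its basis in its own order.\<close>

theorem cohomology_basis_ge_2:
  assumes "2 \<le> n" "distinct ps" "set ps = basis_index c n"
  shows "cohomology_basis (dc c) n (map (\<lambda>(I, j). phi I j) ps)"
proof (rule cohomology_basisI[where \<rho> = "\<lambda>m. reduced_coeff c (ps ! m)"])
  show "set (map (\<lambda>(I, j). phi I j) ps) \<subseteq> cocycles (dc c) n"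
  proof -
    have "phi (fst p) (snd p) \<in> cocycles (dc c) n" if "p \<in> basis_index c n" for p
    proof -
      obtain b i k j where p: "p = ((b, i, k), j)" by (rule index_cases)
      show ?thesis using that assms(1) unfolding p basis_index_def
        by (cases b) (auto intro!: phi_in_cocycles)
    qed
    then show ?thesis using assms(3) by (auto simp: case_prod_beta)
  qed
  show "flinear (reduced_coeff c (ps ! m))" for m by (rule flinear_reduced_coeff)
  have mem: "ps ! m \<in> basis_index c n" if "m < length ps" for m
    using that assms(3) nth_mem by blast
  show "reduced_coeff c (ps ! l) (map (\<lambda>(I, j). phi I j) ps ! m) = 0 \<longleftrightarrow> l \<noteq> m"
    if "l < length (map (\<lambda>(I, j). phi I j) ps)" "m < length (map (\<lambda>(I, j). phi I j) ps)" for l m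
    using that reduced_coeff_phi[OF mem mem, of l m] assms(2)
    by (simp add: case_prod_beta nth_eq_iff_index_eq)
  show "reduced_coeff c (ps ! m) \<phi> = 0"
    if "m < length (map (\<lambda>(I, j). phi I j) ps)" "\<phi> \<in> coboundaries (dc c) n" for m \<phi>
    using that by (intro reduced_coeff_coboundary[OF _ mem]) simp_all
  show "\<phi> \<in> coboundaries (dc c) n"
    if "\<phi> \<in> cocycles (dc c) n"
      "\<And>m. m < length (map (\<lambda>(I, j). phi I j) ps) \<Longrightarrow> reduced_coeff c (ps ! m) \<phi> = 0" for \<phi>
    using that(2) assms(3)
    by (intro coboundary_if_reduced_coeff_0[OF assms(1) that(1)]) (metis in_set_conv_nth length_map)
qed

section \<open>Degree 1, where there are no nonzero coboundaries\<close>

lemma Lsp_0: "Lsp 0 = {\<lambda>_. 0}"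
proof -
  have l0: "Vector_Spaces.linear pscale (*s) (\<lambda>_. 0 :: W)" by unfold_locales auto
  have "\<phi> = (\<lambda>_. 0)" if "\<phi> \<in> Lsp 0" for \<phi>
    using linear_eqI[OF LspD(1)[OF that] l0] LspD(3)[OF that] by blast
  moreover have "(\<lambda>_. 0) \<in> Lsp 0" using l0 by (simp add: Lsp_def)
  ultimately show ?thesis by blast
qed

lemma coboundaries_1: "coboundaries (dc c) 1 = {\<lambda>_. 0}"
  by (simp add: coboundaries_def Lsp_0 coboundary_zero)

text \<open>Cohomology is the space of cocycles here, and plain coordinates serve as dual
  functionals. The fields \<open>y\<partial>\<^sub>x\<close> and \<open>x\<partial>\<^sub>y\<close>
  have eigenvalues \<open>c - 1\<close> and \<open>1 - c\<close>, so they are closed only for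
  \<open>c = 1\<close>.\<close>

theorem cohomology_basis_1:
  assumes "distinct ps"
    and ps: "set ps = {((True, 0, 0), 2), ((True, 0, 0), 3), ((False, 1, 0), 2), ((False, 0, 1), 3)} \<union>
      (if c = 1 then {((False, 0, 1), 2), ((False, 1, 0), 3)} else {})"
  shows "cohomology_basis (dc c) 1 (map (\<lambda>(I, j). phi I j) ps)"
proof (rule cohomology_basisI[where \<rho> = "\<lambda>m \<phi>. \<phi> (wb (fst (ps ! m))) $ snd (ps ! m)"])
  show "set (map (\<lambda>(I, j). phi I j) ps) \<subseteq> cocycles (dc c) 1"
    by (auto simp: ps intro!: phi_in_cocycles split: if_splits)
  show "flinear (\<lambda>\<phi>. \<phi> (wb (fst (ps ! m))) $ snd (ps ! m))" for m
    by (simp add: flinear_def)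
  show "(map (\<lambda>(I, j). phi I j) ps ! m) (wb (fst (ps ! l))) $ snd (ps ! l) = 0 \<longleftrightarrow> l \<noteq> m"
    if "l < length (map (\<lambda>(I, j). phi I j) ps)" "m < length (map (\<lambda>(I, j). phi I j) ps)" for l m
  proof -
    have "ps ! l = ps ! m \<longleftrightarrow> l = m" using that assms(1) by (simp add: nth_eq_iff_index_eq)
    moreover have "mfact I \<noteq> 0" for I by (cases I) simp
    ultimately show ?thesis
      using that by (auto simp: case_prod_beta phi_wb prod_eq_iff)
  qed
  show "\<phi> (wb (fst (ps ! m))) $ snd (ps ! m) = 0" if "\<phi> \<in> coboundaries (dc c) 1" for m \<phi>
    using that unfolding coboundaries_1 by simp
  fix \<phi> assume \<phi>: "\<phi> \<in> cocycles (dc c) 1"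
    and "\<And>m. m < length (map (\<lambda>(I, j). phi I j) ps) \<Longrightarrow> \<phi> (wb (fst (ps ! m))) $ snd (ps ! m) = 0"
  then have z: "\<forall>p\<in>set ps. \<phi> (wb (fst p)) $ snd p = 0" by (metis in_set_conv_nth length_map)
  have L: "\<phi> \<in> Lsp 1" using \<phi> by (simp add: cocycles_def)
  note coeffs = cocycle_coeffs[OF \<phi>]
  \<comment> \<open>For \<open>x\<partial>\<^sub>x\<close> the eigenvalue is \<open>0\<close>, so
    \<open>coeffs(2)[of 1 0]\<close> eliminates the coefficient of
    \<open>\<theta>\<partial>\<^sub>\<theta>\<close>.\<close>
  have "\<phi> (wb (True, 0, 0)) = 0" "\<phi> (wb (False, 1, 0)) = 0" "\<phi> (wb (False, 0, 1)) = 0"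
    using z coeffs(1) coeffs(2)[of 1 0] coeffs(2)[of 0 1] coeffs(3)[of 1 0]
    by (auto simp: ps vec_eq_iff forall_3 split: if_splits)
  moreover have "mdeg (b, i, k) = 1 \<Longrightarrow> (b, i, k) \<in> {(True, 0, 0), (False, 1, 0), (False, 0, 1)}" for b i k
    by (cases b) auto
  ultimately have "\<phi> (wb I) = 0" for I
    using LspD(3)[OF L, of I] by (cases I) blast
  then have "\<phi> \<in> Lsp 0" using LspD(1)[OF L] by (simp add: Lsp_def)
  then show "\<phi> \<in> coboundaries (dc c) 1" unfolding coboundaries_1 by (simp add: Lsp_0)
qed

section \<open>Solving the weight equations\<close>

lemma basis_index_iff:
  "((b, i, k), j) \<in> basis_index c n \<longleftrightarrow> mdeg (b, i, k) = n \<and>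
     (j = 2 \<and> i = 0 \<and> c * of_nat k = 1 \<or> j = 3 \<and> of_nat i + c * of_nat k = c)"
  unfolding basis_index_def by blast

text \<open>Write the equation as \<open>i = c(1 - k)\<close>. For \<open>k \<ge> 2\<close> it makes
  \<open>c\<close> a nonpositive rational; for \<open>k = 0\<close> it makes \<open>c\<close> a
  natural number, which the bound on \<open>cmod c\<close> and \<open>c \<noteq> 0\<close> reduce to
  \<open>1\<close>.\<close>

lemma weight_solutions_not_nonpos_rat:
  fixes c :: complex
  assumes "cmod c \<le> 1" and c: "\<not> (\<exists>q::rat. q \<le> 0 \<and> c = of_rat q)"
  shows "of_nat i + c * of_nat k = c \<longleftrightarrow> i = 0 \<and> k = 1 \<or> c = 1 \<and> i = 1 \<and> k = 0"
proof
  assume e: "of_nat i + c * of_nat k = c"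
  consider "k = 0" | "k = 1" | k' where "k = Suc (Suc k')" by (metis One_nat_def not0_implies_Suc)
  then show "i = 0 \<and> k = 1 \<or> c = 1 \<and> i = 1 \<and> k = 0"
  proof cases
    case 1
    then have ci: "c = of_nat i" using e by simp
    then have "i \<le> 1" using assms(1) by simp
    moreover have "i \<noteq> 0"
    proof
      assume "i = 0"
      then have "c = of_rat 0" using ci by simp
      then show False using c by blast
    qed
    ultimately have "i = 1" by simp
    then show ?thesis using ci 1 by simp
  next
    case 3
    have nz: "of_nat (Suc k') \<noteq> (0::complex)" by (simp del: of_nat_Suc)
    have "c * of_nat (Suc k') = - of_nat i" using e 3 by (simp add: algebra_simps eq_neg_iff_add_eq_0)
    then have "c = - of_nat i / of_nat (Suc k')" by (rule eq_divide_imp[OF nz])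
    also have "\<dots> = of_rat (- of_nat i / of_nat (Suc k'))" by (simp add: of_rat_divide of_rat_minus of_rat_add)
    finally have "c = of_rat (- of_nat i / of_nat (Suc k'))" .
    moreover have "- of_nat i / of_nat (Suc k') \<le> (0::rat)" by (simp add: divide_nonpos_nonneg)
    ultimately show ?thesis using c by blast
  next
    case 2
    then show ?thesis using e by simp
  qed
qed auto

text \<open>The \<open>\<partial>\<^sub>y\<close>-solutions have \<open>i + k = 1\<close>, so from
  degree 2 on they occur only with the factor \<theta>, in degree exactly 2.\<close>

lemma basis_index_not_nonpos_rat:
  fixes c :: complex
  assumes "cmod c \<le> 1" "\<not> (\<exists>q::rat. q \<le> 0 \<and> c = of_rat q)" "2 \<le> n"
  shows "basis_index c n = {((b, 0, k), 2) | b k. of_bool b + k = n \<and> c * of_nat k = 1} \<union>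
    (if n = 2 then {((True, 0, 1), 3)} \<union> (if c = 1 then {((True, 1, 0), 3)} else {}) else {})"
proof (rule set_eqI)
  fix p :: "midx \<times> 3"
  obtain b i k j where p: "p = ((b, i, k), j)" by (rule index_cases)
  define P where "P \<longleftrightarrow> c * of_nat k = 1"
  define Q where "Q \<longleftrightarrow> c = 1"
  have "p \<in> basis_index c n \<longleftrightarrow> mdeg (b, i, k) = n \<and>
      (j = 2 \<and> i = 0 \<and> P \<or> j = 3 \<and> (i = 0 \<and> k = 1 \<or> Q \<and> i = 1 \<and> k = 0))"
    by (simp add: p P_def Q_def basis_index_def weight_solutions_not_nonpos_rat[OF assms(1,2)])
  also have "\<dots> \<longleftrightarrow> j = 2 \<and> i = 0 \<and> of_bool b + k = n \<and> P \<or>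
      n = 2 \<and> b \<and> j = 3 \<and> (i = 0 \<and> k = 1 \<or> Q \<and> i = 1 \<and> k = 0)"
    using assms(3) by (cases b) auto
  also have "\<dots> \<longleftrightarrow> p \<in> {((b, 0, k), 2) | b k. of_bool b + k = n \<and> c * of_nat k = 1} \<union>
    (if n = 2 then {((True, 0, 1), 3)} \<union> (if c = 1 then {((True, 1, 0), 3)} else {}) else {})"
    by (simp add: p P_def Q_def) blast
  finally show "p \<in> basis_index c n \<longleftrightarrow> p \<in> {((b, 0, k), 2) | b k. of_bool b + k = n \<and> c * of_nat k = 1} \<union>
    (if n = 2 then {((True, 0, 1), 3)} \<union> (if c = 1 then {((True, 1, 0), 3)} else {}) else {})" .
qed

text \<open>With \<open>c = -r/u\<close> the equation reads \<open>ui = r(k - 1)\<close>, and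
  coprimality makes \<open>r\<close> divide \<open>i\<close>. It is kept as
  \<open>ui + r = rk\<close> to avoid truncated subtraction.\<close>

lemma weight_solutions_neg_rat:
  fixes c :: complex
  assumes c: "c * of_nat u = - of_nat r" and "0 < r" "0 < u" "coprime r u"
  shows "of_nat i + c * of_nat k = c \<longleftrightarrow> (\<exists>t. i = t * r \<and> k = t * u + 1)"
proof -
  have "of_nat i + c * of_nat k = c \<longleftrightarrow> of_nat u * (of_nat i + c * of_nat k) = of_nat u * c"
    using assms(3) by simp
  also have "\<dots> \<longleftrightarrow> of_nat (u * i + r) = (of_nat (r * k) :: complex)"
  proof -
    have "of_nat u * (of_nat i + c * of_nat k) = of_nat (u * i) + (c * of_nat u) * of_nat k"
      by (simp add: algebra_simps)
    then have "of_nat u * (of_nat i + c * of_nat k) = of_nat (u * i) - of_nat (r * k)"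
      by (simp add: c)
    moreover have "of_nat u * c = - of_nat r" using c by (simp add: mult.commute)
    ultimately have "of_nat u * (of_nat i + c * of_nat k) = of_nat u * c \<longleftrightarrow>
        of_nat (u * i) - of_nat (r * k) = - (of_nat r :: complex)" by simp
    then show ?thesis by (simp only: of_nat_add diff_eq_eq) (auto simp: algebra_simps)
  qed
  also have "\<dots> \<longleftrightarrow> u * i + r = r * k" by (rule of_nat_eq_iff)
  also have "\<dots> \<longleftrightarrow> (\<exists>t. i = t * r \<and> k = t * u + 1)"
  proof
    assume e: "u * i + r = r * k"
    then have "r dvd u * i" by (metis dvd_add_left_iff dvd_refl dvd_triv_left)
    then have "r dvd i" using assms(4) by (simp add: coprime_dvd_mult_right_iff)
    then obtain t where t: "i = t * r" by (metis dvd_def mult.commute)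
    then have "r * (t * u + 1) = r * k" using e by (simp add: algebra_simps)
    then have "t * u + 1 = k" using assms(2) by (metis nat_mult_eq_cancel1)
    then show "\<exists>t. i = t * r \<and> k = t * u + 1" using t by auto
  qed (auto simp: algebra_simps)
  finally show ?thesis .
qed

text \<open>A negative \<open>c\<close> excludes \<open>ck = 1\<close>, so only
  \<open>\<partial>\<^sub>y\<close>-fields remain. The value \<open>t = 0\<close> gives
  \<open>y\<partial>\<^sub>y\<close> and \<open>\<theta>y\<partial>\<^sub>y\<close>.\<close>

lemma basis_index_neg_rat:
  fixes c :: complex
  assumes c: "c * of_nat u = - of_nat r" and "0 < r" "0 < u" "coprime r u"
  shows "basis_index c n = {((b, t * r, t * u + 1), 3) | b t. of_bool b + t * (r + u) + 1 = n}"
proof -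
  have "c * of_nat k \<noteq> 1" for k
  proof
    assume "c * of_nat k = 1"
    then have "c * of_nat u * of_nat k = of_nat u" by (simp add: algebra_simps)
    then have "of_nat u = - of_nat r * (of_nat k :: complex)" unfolding c by (rule sym)
    then have "of_nat (u + r * k) = (of_nat 0 :: complex)" by simp
    then show False using assms(3) by (simp only: of_nat_eq_iff)
  qed
  then have "basis_index c n = {((b, i, k), j) | b i k j. mdeg (b, i, k) = n \<and> j = 3 \<and>
      (\<exists>t. i = t * r \<and> k = t * u + 1)}"
    by (simp only: basis_index_def weight_solutions_neg_rat[OF assms] simp_thms)
  moreover have "of_bool b + t * (r + u) + 1 = mdeg (b, t * r, t * u + 1)" for b t
    by (simp add: algebra_simps)
  ultimately show ?thesis by (simp only:) blast
qed

text \<open>Here \<open>E = x\<partial>\<^sub>x\<close> commutes with every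
  \<open>y^k\<partial>\<^sub>y\<close>, so no degree is empty.\<close>

lemma basis_index_0:
  assumes "2 \<le> n"
  shows "basis_index 0 n = {((True, 0, n - 1), 3), ((False, 0, n), 3)}"
proof (rule set_eqI)
  fix p :: "midx \<times> 3"
  obtain b i k j where p: "p = ((b, i, k), j)" by (rule index_cases)
  show "p \<in> basis_index 0 n \<longleftrightarrow> p \<in> {((True, 0, n - 1), 3), ((False, 0, n), 3)}"
  proof (cases b)
    case True
    have "p \<in> basis_index 0 n \<longleftrightarrow> Suc (i + k) = n \<and> j = 3 \<and> i = 0"
      by (simp add: p basis_index_iff True)
    then show ?thesis using assms by (simp add: p True) auto
  next
    case False
    have "p \<in> basis_index 0 n \<longleftrightarrow> i + k = n \<and> j = 3 \<and> i = 0"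
      by (simp add: p basis_index_iff False)
    then show ?thesis using assms by (simp add: p False) auto
  qed
qed

section \<open>The weights for each value of \<open>c\<close>\<close>

lemma cohomology_basis_1_not_1:
  assumes "c \<noteq> 1"
  shows "cohomology_basis (dc c) 1
    [psi (True, 0, 0) 2, psi (True, 0, 0) 3, phi (False, 1, 0) 2, phi (False, 0, 1) 3]"
  using assms cohomology_basis_1[where c = c and ps =
      "[((True, 0, 0), 2), ((True, 0, 0), 3), ((False, 1, 0), 2), ((False, 0, 1), 3)]"]
  by simp

lemma cohomology_basis_empty:
  assumes "2 \<le> n" "basis_index c n = {}"
  shows "cohomology_basis (dc c) n []"
  using cohomology_basis_ge_2[of n "[]" c] assms by simp

lemma cohomology_basis_single:
  assumes "2 \<le> n" "basis_index c n = {(I, j)}"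
  shows "cohomology_basis (dc c) n [phi I j]"
  using cohomology_basis_ge_2[of n "[(I, j)]" c] assms by simp

lemma cohomology_generic:
  fixes c :: complex
  assumes "cmod c \<le> 1" "\<not> (\<exists>q::rat. q \<le> 0 \<and> c = of_rat q)"
    "\<not> (\<exists>m::nat. 0 < m \<and> 1 / c = of_nat m)"
  shows "cohomology_basis (dc c) 1
      [psi (True, 0, 0) 2, psi (True, 0, 0) 3, phi (False, 1, 0) 2, phi (False, 0, 1) 3]"
    and "cohomology_basis (dc c) 2 [psi (True, 0, 1) 3]"
    and "\<And>n. 2 < n \<Longrightarrow> cohomology_basis (dc c) n []"
proof -
  have "c * of_nat k \<noteq> 1" for k
  proof
    assume h: "c * of_nat k = 1"
    then have "c \<noteq> 0" "k \<noteq> 0" by (auto intro!: Nat.gr0I)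
    then have "1 / c = of_nat k" using h by (simp add: divide_eq_eq mult.commute)
    then show False using assms(3) \<open>k \<noteq> 0\<close> by auto
  qed
  moreover have c1: "c \<noteq> 1" using assms(3) by (auto intro: exI[of _ 1])
  ultimately have B: "basis_index c n = (if n = 2 then {((True, 0, 1), 3)} else {})" if "2 \<le> n" for n
    using basis_index_not_nonpos_rat[OF assms(1,2) that] by auto
  show "cohomology_basis (dc c) 1
      [psi (True, 0, 0) 2, psi (True, 0, 0) 3, phi (False, 1, 0) 2, phi (False, 0, 1) 3]"
    using c1 by (rule cohomology_basis_1_not_1)
  show "cohomology_basis (dc c) 2 [psi (True, 0, 1) 3]"
    "\<And>n. 2 < n \<Longrightarrow> cohomology_basis (dc c) n []"
    using B by (auto intro!: cohomology_basis_single cohomology_basis_empty)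
qed

lemma not_nonpos_rat_inverse_nat:
  fixes c :: complex
  assumes "0 < m" "1 / c = of_nat m"
  shows "\<not> (\<exists>q::rat. q \<le> 0 \<and> c = of_rat q)"
proof
  assume "\<exists>q::rat. q \<le> 0 \<and> c = of_rat q"
  then obtain q :: rat where q: "q \<le> 0" "c = of_rat q" by blast
  then have "of_rat (1 / q) = (of_rat (of_nat m) :: complex)" using assms(2) by (simp add: of_rat_divide)
  then have "1 / q = of_nat m" by (simp only: of_rat_eq_iff)
  \<comment> \<open>This includes \<open>q = 0\<close>, where \<open>1 / q = 0\<close>.\<close>
  moreover have "1 / q \<le> 0" using q(1) by simp
  ultimately show False using assms(1) by simp
qed

lemma cohomology_1:
  shows "cohomology_basis (dc 1) 1
      [psi (True, 0, 0) 2, psi (True, 0, 0) 3, phi (False, 1, 0) 2, phi (False, 0, 1) 3, phi (False, 0, 1) 2,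
       phi (False, 1, 0) 3]"
    and "cohomology_basis (dc 1) 2 [psi (True, 0, 1) 3, psi (True, 0, 1) 2, psi (True, 1, 0) 3]"
    and "\<And>n. 2 < n \<Longrightarrow> cohomology_basis (dc 1) n []"
proof -
  show "cohomology_basis (dc 1) 1
      [psi (True, 0, 0) 2, psi (True, 0, 0) 3, phi (False, 1, 0) 2, phi (False, 0, 1) 3, phi (False, 0, 1) 2,
       phi (False, 1, 0) 3]"
    using cohomology_basis_1[where c = 1 and ps =
      "[((True, 0, 0), 2), ((True, 0, 0), 3), ((False, 1, 0), 2), ((False, 0, 1), 3), ((False, 0, 1), 2),
        ((False, 1, 0), 3)]"]
    by auto
  have B: "basis_index 1 n = (if n = 2 then
      {((True, 0, 1), 3), ((True, 0, 1), 2), ((True, 1, 0), 3)} else {})" if "2 \<le> n" for n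
    using basis_index_not_nonpos_rat[OF _ not_nonpos_rat_inverse_nat[of 1 1] that] that
    by auto
  show "cohomology_basis (dc 1) 2 [psi (True, 0, 1) 3, psi (True, 0, 1) 2, psi (True, 1, 0) 3]"
    using cohomology_basis_ge_2[of 2 "[((True, 0, 1), 3), ((True, 0, 1), 2), ((True, 1, 0), 3)]" 1] B[of 2]
    by simp
  show "\<And>n. 2 < n \<Longrightarrow> cohomology_basis (dc 1) n []"
    using B by (auto intro!: cohomology_basis_empty)
qed

text \<open>The equation \<open>ck = 1\<close> now has the solution \<open>k = m\<close>, adding
  \<open>y^m\<partial>\<^sub>x\<close> in degree \<open>m\<close> and its \<theta>-multiple in
  degree \<open>m + 1\<close>. For \<open>m = 2\<close> the former shares its degree with
  \<open>\<theta>y\<partial>\<^sub>y\<close>.\<close>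

lemma cohomology_inverse_nat:
  fixes c :: complex
  assumes c1: "cmod c \<le> 1" and m: "0 < m" "1 / c = of_nat m" "c \<noteq> 1"
  shows "cohomology_basis (dc c) 1
      [psi (True, 0, 0) 2, psi (True, 0, 0) 3, phi (False, 1, 0) 2, phi (False, 0, 1) 3]"
    and "2 < m \<Longrightarrow> cohomology_basis (dc c) 2 [psi (True, 0, 1) 3]"
    and "2 < m \<Longrightarrow> cohomology_basis (dc c) m [phi (False, 0, m) 2]"
    and "m = 2 \<Longrightarrow> cohomology_basis (dc c) 2 [psi (True, 0, 1) 3, phi (False, 0, 2) 2]"
    and "cohomology_basis (dc c) (m + 1) [psi (True, 0, m) 2]"
    and "\<And>n. \<lbrakk>1 \<le> n; n \<notin> {1, 2, m, m + 1}\<rbrakk> \<Longrightarrow> cohomology_basis (dc c) n []"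
proof -
  show "cohomology_basis (dc c) 1
      [psi (True, 0, 0) 2, psi (True, 0, 0) 3, phi (False, 1, 0) 2, phi (False, 0, 1) 3]"
    using m(3) by (rule cohomology_basis_1_not_1)
  \<comment> \<open>Because \<open>1 / 0 = 0\<close>, whereas \<open>m\<close> is positive.\<close>
  have "c \<noteq> 0" using m by auto
  then have "c * of_nat k = 1 \<longleftrightarrow> of_nat k = 1 / c" for k by (auto simp: field_simps)
  then have k: "c * of_nat k = 1 \<longleftrightarrow> k = m" for k using m(2) by simp
  have "m \<noteq> 1" using m by auto
  with m(1) have m2: "2 \<le> m" by simp
  have B: "basis_index c n = (if n = m then {((False, 0, m), 2)} else {}) \<union>
      (if n = m + 1 then {((True, 0, m), 2)} else {}) \<union> (if n = 2 then {((True, 0, 1), 3)} else {})"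
    if "2 \<le> n" for n
    using basis_index_not_nonpos_rat[OF c1 not_nonpos_rat_inverse_nat[OF m(1,2)] that] m(3)
    by (auto simp: k)
  show "2 < m \<Longrightarrow> cohomology_basis (dc c) 2 [psi (True, 0, 1) 3]"
    "2 < m \<Longrightarrow> cohomology_basis (dc c) m [phi (False, 0, m) 2]"
    "cohomology_basis (dc c) (m + 1) [psi (True, 0, m) 2]"
    "\<And>n. \<lbrakk>1 \<le> n; n \<notin> {1, 2, m, m + 1}\<rbrakk> \<Longrightarrow> cohomology_basis (dc c) n []"
    using B m2 by (auto intro!: cohomology_basis_single cohomology_basis_empty)
  show "m = 2 \<Longrightarrow> cohomology_basis (dc c) 2 [psi (True, 0, 1) 3, phi (False, 0, 2) 2]"
    using cohomology_basis_ge_2[of 2 "[((True, 0, 1), 3), ((False, 0, 2), 2)]" c] B[of 2]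
    by (simp add: insert_commute)
qed

text \<open>Solving for \<open>c\<close> gives \<open>c = -r/(s - r)\<close>, so
  \<open>basis_index_neg_rat\<close> applies with \<open>u = s - r\<close> and the degrees are
  \<open>ts + 1\<close> without \<theta> and \<open>ts + 2\<close> with it.\<close>

lemma cohomology_neg_rat:
  fixes c :: complex and q :: rat
  assumes q: "c = of_rat q" "q < 0" and rs: "0 < r" "0 < s" "coprime r s"
    and e: "c / (c - 1) = of_nat r / of_nat s"
  shows "cohomology_basis (dc c) 1
      [psi (True, 0, 0) 2, psi (True, 0, 0) 3, phi (False, 1, 0) 2, phi (False, 0, 1) 3]"
    and "cohomology_basis (dc c) 2 [psi (True, 0, 1) 3]"
    and "\<And>k. 1 \<le> k \<Longrightarrow> cohomology_basis (dc c) (k * s + 1) [phi (False, k * r, k * (s - r) + 1) 3]"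
    and "\<And>k. 1 \<le> k \<Longrightarrow> cohomology_basis (dc c) (k * s + 2) [psi (True, k * r, k * (s - r) + 1) 3]"
    and "\<And>n. \<lbrakk>1 \<le> n; n \<notin> {1, 2}; \<not> (\<exists>k\<ge>1. n = k * s + 1 \<or> n = k * s + 2)\<rbrakk>
           \<Longrightarrow> cohomology_basis (dc c) n []"
proof -
  show "cohomology_basis (dc c) 1
      [psi (True, 0, 0) 2, psi (True, 0, 0) 3, phi (False, 1, 0) 2, phi (False, 0, 1) 3]"
    using q by (intro cohomology_basis_1_not_1) auto
  have "of_rat (q / (q - 1)) = (of_rat (of_nat r / of_nat s) :: complex)"
    using e by (simp add: q of_rat_divide of_rat_diff)
  then have "q / (q - 1) = of_nat r / of_nat s" by (simp only: of_rat_eq_iff)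
  then have qs: "q * (of_nat s - of_nat r) = - of_nat r"
    using q(2) rs(2) by (simp add: field_simps)
  \<comment> \<open>The sign of \<open>q\<close> forces \<open>r < s\<close>, so the subtraction
    \<open>s - r\<close> of naturals is not truncated.\<close>
  then have "q * (of_nat s - of_nat r) < 0" using rs(1) by simp
  then have "(of_nat r :: rat) < of_nat s" using q(2) by (simp add: mult_less_0_iff)
  then have rs': "r < s" by simp
  then have "q * of_nat (s - r) = - of_nat r" using qs by (simp add: of_nat_diff)
  then have "of_rat (q * of_nat (s - r)) = (of_rat (- of_nat r) :: complex)" by (simp only:)
  then have cu: "c * of_nat (s - r) = - of_nat r" by (simp add: q of_rat_mult of_rat_minus)
  have co: "coprime r (s - r)"
    using rs(3) rs' gcd_diff1_nat[of r s] by (simp add: coprime_iff_gcd_eq_1 gcd.commute)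
  have B: "basis_index c n = {((b, t * r, t * (s - r) + 1), 3) | b t. of_bool b + t * s + 1 = n}" for n
    using basis_index_neg_rat[OF cu rs(1) _ co, of n] rs' by simp
  have s2: "2 \<le> s" using rs' rs(1) by linarith
  \<comment> \<open>As \<open>s \<ge> 2\<close>, the degrees \<open>ts + 1\<close> and
    \<open>ks + 2\<close> differ modulo \<open>s\<close>, so each degree carries at most one
    field.\<close>
  have ts: "t * s \<noteq> Suc (k * s)" "(t * s = k * s) = (t = k)" for t k
    using s2 by (auto dest: arg_cong[where f = "\<lambda>x. x mod s"] simp: mod_Suc)
  show "cohomology_basis (dc c) 2 [psi (True, 0, 1) 3]"
  proof (rule cohomology_basis_single)
    show "basis_index c 2 = {((True, 0, 1), 3)}"
      using s2 ts(1)[of _ 0] unfolding B by (auto simp: of_bool_def split: if_splits)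
  qed simp
  show "cohomology_basis (dc c) (k * s + 1) [phi (False, k * r, k * (s - r) + 1) 3]" if "1 \<le> k" for k
  proof (rule cohomology_basis_single)
    show "2 \<le> k * s + 1" using that s2 by simp
    show "basis_index c (k * s + 1) = {((False, k * r, k * (s - r) + 1), 3)}"
      unfolding B using ts(1)[of k, symmetric] ts(2)[of _ k] by (auto simp: of_bool_def split: if_splits)
  qed
  show "cohomology_basis (dc c) (k * s + 2) [psi (True, k * r, k * (s - r) + 1) 3]" if "1 \<le> k" for k
  proof (rule cohomology_basis_single)
    show "basis_index c (k * s + 2) = {((True, k * r, k * (s - r) + 1), 3)}"
      unfolding B using ts(1)[of _ k] ts(2)[of _ k] by (auto simp: of_bool_def split: if_splits)
  qed simp
  show "cohomology_basis (dc c) n []"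
    if n: "1 \<le> n" "n \<notin> {1, 2}" "\<not> (\<exists>k\<ge>1. n = k * s + 1 \<or> n = k * s + 2)" for n
  proof (rule cohomology_basis_empty)
    show "2 \<le> n" using n by auto
    have "of_bool b + t * s + 1 \<noteq> n" for b t
    \<comment> \<open>For \<open>t = 0\<close> the degrees are 1 and 2, which are excluded
      separately.\<close>
    proof (cases "t = 0")
      case False
      then have "n \<noteq> t * s + 1 \<and> n \<noteq> t * s + 2" using n(3) by (metis One_nat_def Suc_leI neq0_conv)
      then show ?thesis by (cases b) auto
    qed (use n in \<open>cases b; auto\<close>)
    then show "basis_index c n = {}" unfolding B by blast
  qed
qed

lemma cohomology_0:
  shows "cohomology_basis (dc 0) 1
      [psi (True, 0, 0) 2, psi (True, 0, 0) 3, phi (False, 1, 0) 2, phi (False, 0, 1) 3]"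
    and "\<And>n. 1 < n \<Longrightarrow> cohomology_basis (dc 0) n [psi (True, 0, n - 1) 3, phi (False, 0, n) 3]"
proof -
  show "cohomology_basis (dc 0) 1
      [psi (True, 0, 0) 2, psi (True, 0, 0) 3, phi (False, 1, 0) 2, phi (False, 0, 1) 3]"
    by (rule cohomology_basis_1_not_1) simp
  show "cohomology_basis (dc 0) n [psi (True, 0, n - 1) 3, phi (False, 0, n) 3]" if "1 < n" for n
    using cohomology_basis_ge_2[of n "[((True, 0, n - 1), 3), ((False, 0, n), 3)]" 0]
      basis_index_0[of n] that by simp
qed

theorem mainTheorem6:
  fixes c :: complex
  assumes "cmod c \<le> 1"
  shows
    "(\<not> (\<exists>q::rat. q \<le> 0 \<and> c = of_rat q) \<and>
      \<not> (\<exists>m::nat. 0 < m \<and> c = of_nat m) \<and>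
      \<not> (\<exists>m::nat. 0 < m \<and> 1 / c = of_nat m) \<longrightarrow>
        cohomology_basis (dc c) 1
          [psi (True, 0, 0) 2, psi (True, 0, 0) 3, phi (False, 1, 0) 2, phi (False, 0, 1) 3] \<and>
        cohomology_basis (dc c) 2 [psi (True, 0, 1) 3] \<and>
        (\<forall>n>2. cohomology_basis (dc c) n []))
    \<and>
     (c = 1 \<longrightarrow>
        cohomology_basis (dc c) 1
          [psi (True, 0, 0) 2, psi (True, 0, 0) 3, phi (False, 1, 0) 2, phi (False, 0, 1) 3, phi (False, 0, 1) 2,
           phi (False, 1, 0) 3] \<and>
        cohomology_basis (dc c) 2 [psi (True, 0, 1) 3, psi (True, 0, 1) 2, psi (True, 1, 0) 3] \<and>
        (\<forall>n>2. cohomology_basis (dc c) n []))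
    \<and>
     (\<forall>m::nat. 0 < m \<and> 1 / c = of_nat m \<and> c \<noteq> 1 \<longrightarrow>
        cohomology_basis (dc c) 1
          [psi (True, 0, 0) 2, psi (True, 0, 0) 3, phi (False, 1, 0) 2, phi (False, 0, 1) 3] \<and>
        (m > 2 \<longrightarrow>
          cohomology_basis (dc c) 2 [psi (True, 0, 1) 3] \<and>
          cohomology_basis (dc c) m [phi (False, 0, m) 2]) \<and>
        (m = 2 \<longrightarrow>
          cohomology_basis (dc c) 2 [psi (True, 0, 1) 3, phi (False, 0, 2) 2]) \<and>
        cohomology_basis (dc c) (m + 1) [psi (True, 0, m) 2] \<and>
        (\<forall>n\<ge>1. n \<notin> {1, 2, m, m + 1} \<longrightarrow> cohomology_basis (dc c) n []))
    \<and>
     (c = 0 \<longrightarrow>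
        cohomology_basis (dc c) 1
          [psi (True, 0, 0) 2, psi (True, 0, 0) 3, phi (False, 1, 0) 2, phi (False, 0, 1) 3] \<and>
        (\<forall>n>1. cohomology_basis (dc c) n [psi (True, 0, n - 1) 3, phi (False, 0, n) 3]))
    \<and>
     (\<forall>(q::rat) (r::nat) (s::nat). c = of_rat q \<and> -1 \<le> q \<and> q < 0 \<and>
        0 < r \<and> 0 < s \<and> coprime r s \<and> c / (c - 1) = of_nat r / of_nat s \<longrightarrow>
        cohomology_basis (dc c) 1
          [psi (True, 0, 0) 2, psi (True, 0, 0) 3, phi (False, 1, 0) 2, phi (False, 0, 1) 3] \<and>
        cohomology_basis (dc c) 2 [psi (True, 0, 1) 3] \<and>
        (\<forall>k\<ge>1. cohomology_basis (dc c) (k * s + 1) [phi (False, k * r, k * (s - r) + 1) 3] \<and>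
               cohomology_basis (dc c) (k * s + 2) [psi (True, k * r, k * (s - r) + 1) 3]) \<and>
        (\<forall>n\<ge>1. n \<notin> {1, 2} \<and> \<not> (\<exists>k\<ge>1. n = k * s + 1 \<or> n = k * s + 2) \<longrightarrow>
               cohomology_basis (dc c) n []))"
proof (rule conjI[OF _ conjI[OF _ conjI[OF _ conjI]]], goal_cases)
  case 1
  show ?case
    by (intro impI conjI allI; elim conjE; rule cohomology_generic[OF assms]; assumption)
next
  case 2
  show ?case by (intro impI conjI allI; hypsubst; rule cohomology_1; assumption)
next
  case 3
  show ?case
    by (intro impI conjI allI; elim conjE; rule cohomology_inverse_nat[OF assms]; assumption)
next
  case 4
  show ?case by (intro impI conjI allI; hypsubst; rule cohomology_0; assumption)
next
  case 5
  show ?case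
    by (intro impI conjI allI; elim conjE; rule cohomology_neg_rat; assumption)
qed

end
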